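(* Let $\Gamma$ be a (Gromov) hyperbolic uniform graph with a pole. Then $h(\Gamma)>0$ if and only if $\partial_\infty\Gamma$ is uniformly perfect for some visual metric.
   Context: Graphs are connected and carry the length metric in which every edge has length $1$. A graph is uniform if there is a constant $\mu$ such that every vertex has at most $\mu$ neighbors. The Cheeger constant is $h(\Gamma)=\inf_A|\partial A|/|A|$, with $A$ ranging over non-empty finite sets of vertices and $\partial A$ the set of vertices at distance exactly $1$ from $A$. A metric space $X$ is hyperbolic if there is $\delta\ge0$ with $(x|y)_o\ge\min\{(x|z)_o,(z|y)_o\}-\delta$ for all $x,y,z,o\in X$, where $(x|y)_o=\frac12(d(x,o)+d(y,o)-d(x,y))$. A geodesic space $X$ has a pole in a point $v$ if there is $M>0$ such that each point of $X$ lies in the $M$-neighborhood of some geodesic ray emanating from $v$. A sequence $\{x_i\}$ in $X$ converges to infinity if $(x_i|x_j)_o\to\infty$ as $i,j\to\infty$; two such sequences are equivalent if $(x_i|x_i')_o\to\infty$. The boundary $\partial_\infty X$ is the set of equivalence classes. For $\xi,\xi'\in\partial_\infty X$, $(\xi|\xi')_o=\inf\liminf_{i\to\infty}(x_i|x'_i)_o$, the infimum over all $\{x_i\}\in\xi$, $\{x_i'\}\in\xi'$. A metric $d$ on $\partial_\infty X$ is visual if there are $o\in X$, $a>1$ and $c_1,c_2>0$ with $c_1a^{-(\xi|\xi')_o}\le d(\xi,\xi')\le c_2a^{-(\xi|\xi')_o}$ for all $\xi,\xi'$. A metric space $(Z,d)$ is uniformly perfect if there are $S>1$ and $\varepsilon_0>0$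 such that for every $x\in Z$ and every $0<\varepsilon\le\varepsilon_0$ there is $y\in Z$ with $\frac{\varepsilon}{S}<d(x,y)\le\varepsilon$. *)

theory Defs
  imports "HOL-Analysis.Analysis"
begin

text \<open>
  A graph is given by its vertex set and its adjacency relation; an undirected edge appears as
  the two pairs (u, v) and (v, u).
\<close>

definition simple_graph :: "'a set \<Rightarrow> ('a \<times> 'a) set \<Rightarrow> bool" where
  "simple_graph V E \<longleftrightarrow> E \<subseteq> V \<times> V \<and> sym E \<and> irrefl E"

definition connected_graph :: "'a set \<Rightarrow> ('a \<times> 'a) set \<Rightarrow> bool" where
  "connected_graph V E \<longleftrightarrow>
     simple_graph V E \<and> V \<noteq> {} \<and> (\<forall>u\<in>V. \<forall>v\<in>V. (u, v) \<in> E\<^sup>*)"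

definition uniform_graph :: "'a set \<Rightarrow> ('a \<times> 'a) set \<Rightarrow> bool" where
  "uniform_graph V E \<longleftrightarrow>
     (\<exists>\<mu>::nat. \<forall>v\<in>V. finite (E `` {v}) \<and> card (E `` {v}) \<le> \<mu>)"

text \<open>
  The underlying metric space of a graph is its geometric realisation. Points are written in
  barycentric coordinates, so a point is a function from vertices to reals:
  \<open>vertex_point v\<close> is the vertex v, and \<open>edge_point u v t\<close> lies at distance t from u on the
  edge uv. Note that \<open>edge_point u v t = edge_point v u (1 - t)\<close> and
  \<open>edge_point u v 0 = vertex_point u\<close>.
\<close>

definition vertex_point :: "'a \<Rightarrow> 'a \<Rightarrow> real" where
  "vertex_point v = indicator {v}"

definition edge_point :: "'a \<Rightarrow> 'a \<Rightarrow> real \<Rightarrow> 'a \<Rightarrow> real" where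
  "edge_point u v t = (\<lambda>x. (1 - t) * vertex_point u x + t * vertex_point v x)"

definition graph_points :: "'a set \<Rightarrow> ('a \<times> 'a) set \<Rightarrow> ('a \<Rightarrow> real) set" where
  "graph_points V E =
     vertex_point ` V \<union> {edge_point u v t | u v t. (u, v) \<in> E \<and> 0 \<le> t \<and> t \<le> 1}"

text \<open>
  \<open>polygonal_path E p q L\<close>: there is a path of length L from p to q that is a finite
  concatenation of segments, each contained in one closed edge of length 1. The length metric is
  the infimum of these lengths.
\<close>

inductive polygonal_path ::
  "('a \<times> 'a) set \<Rightarrow> ('a \<Rightarrow> real) \<Rightarrow> ('a \<Rightarrow> real) \<Rightarrow> real \<Rightarrow> bool"
  for E where
  trivial: "polygonal_path E p p 0"
| segment: "polygonal_path E (edge_point u v s) q (\<bar>s - t\<bar> + L)"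
    if "(u, v) \<in> E" "0 \<le> s" "s \<le> 1" "0 \<le> t" "t \<le> 1"
       "polygonal_path E (edge_point u v t) q L"

definition graph_dist :: "('a \<times> 'a) set \<Rightarrow> ('a \<Rightarrow> real) \<Rightarrow> ('a \<Rightarrow> real) \<Rightarrow> real" where
  "graph_dist E p q = Inf {L. polygonal_path E p q L}"

definition vertex_boundary :: "'a set \<Rightarrow> ('a \<times> 'a) set \<Rightarrow> 'a set \<Rightarrow> 'a set" where
  "vertex_boundary V E A =
     {v \<in> V. (INF a\<in>A. graph_dist E (vertex_point v) (vertex_point a)) = 1}"

text \<open>
  Intended for locally finite graphs only: there the boundary of a finite set is finite, so that
  \<open>card\<close> is its actual number of elements.
\<close>

definition cheeger_constant :: "'a set \<Rightarrow> ('a \<times> 'a) set \<Rightarrow> real" where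
  "cheeger_constant V E =
     (INF A \<in> {A. A \<subseteq> V \<and> A \<noteq> {} \<and> finite A}.
        real (card (vertex_boundary V E A)) / real (card A))"

text \<open>
  The following notions concern a metric space with carrier X and distance function d.
\<close>

definition gromov_product :: "('p \<Rightarrow> 'p \<Rightarrow> real) \<Rightarrow> 'p \<Rightarrow> 'p \<Rightarrow> 'p \<Rightarrow> real" where
  "gromov_product d b x y = (d x b + d y b - d x y) / 2"

definition gromov_hyperbolic :: "'p set \<Rightarrow> ('p \<Rightarrow> 'p \<Rightarrow> real) \<Rightarrow> bool" where
  "gromov_hyperbolic X d \<longleftrightarrow>
     (\<exists>\<delta>\<ge>0. \<forall>x\<in>X. \<forall>y\<in>X. \<forall>z\<in>X. \<forall>b\<in>X.
        gromov_product d b x y \<ge> min (gromov_product d b x z) (gromov_product d b z y) - \<delta>)"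

definition geodesic_ray_from ::
  "'p set \<Rightarrow> ('p \<Rightarrow> 'p \<Rightarrow> real) \<Rightarrow> 'p \<Rightarrow> (real \<Rightarrow> 'p) \<Rightarrow> bool" where
  "geodesic_ray_from X d v \<gamma> \<longleftrightarrow>
     \<gamma> ` {0..} \<subseteq> X \<and> \<gamma> 0 = v \<and> (\<forall>s\<ge>0. \<forall>t\<ge>0. d (\<gamma> s) (\<gamma> t) = \<bar>s - t\<bar>)"

definition pole_in :: "'p set \<Rightarrow> ('p \<Rightarrow> 'p \<Rightarrow> real) \<Rightarrow> 'p \<Rightarrow> bool" where
  "pole_in X d v \<longleftrightarrow>
     (\<exists>M>0. \<forall>x\<in>X. \<exists>\<gamma>. geodesic_ray_from X d v \<gamma> \<and> (\<exists>t\<ge>0. d x (\<gamma> t) < M))"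

definition has_pole :: "'p set \<Rightarrow> ('p \<Rightarrow> 'p \<Rightarrow> real) \<Rightarrow> bool" where
  "has_pole X d \<longleftrightarrow> (\<exists>v\<in>X. pole_in X d v)"

text \<open>
  In the next two definitions the base point b is irrelevant, since changing it from b to b'
  changes Gromov products by at most d(b, b').
\<close>

definition converges_to_infinity :: "'p set \<Rightarrow> ('p \<Rightarrow> 'p \<Rightarrow> real) \<Rightarrow> (nat \<Rightarrow> 'p) \<Rightarrow> bool" where
  "converges_to_infinity X d x \<longleftrightarrow>
     range x \<subseteq> X \<and>
     (\<forall>b\<in>X. filterlim (\<lambda>(i, j). gromov_product d b (x i) (x j)) at_top
               (sequentially \<times>\<^sub>F sequentially))"

definition boundary_equiv ::
  "'p set \<Rightarrow> ('p \<Rightarrow> 'p \<Rightarrow> real) \<Rightarrow> ((nat \<Rightarrow> 'p) \<times> (nat \<Rightarrow> 'p)) set" where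
  "boundary_equiv X d =
     {(x, y). converges_to_infinity X d x \<and> converges_to_infinity X d y \<and>
        (\<forall>b\<in>X. filterlim (\<lambda>i. gromov_product d b (x i) (y i)) at_top sequentially)}"

definition gromov_boundary :: "'p set \<Rightarrow> ('p \<Rightarrow> 'p \<Rightarrow> real) \<Rightarrow> (nat \<Rightarrow> 'p) set set" where
  "gromov_boundary X d = {x. converges_to_infinity X d x} // boundary_equiv X d"

definition boundary_product ::
  "('p \<Rightarrow> 'p \<Rightarrow> real) \<Rightarrow> 'p \<Rightarrow> (nat \<Rightarrow> 'p) set \<Rightarrow> (nat \<Rightarrow> 'p) set \<Rightarrow> ereal" where
  "boundary_product d b \<xi> \<eta> =
     (INF (x, y) \<in> \<xi> \<times> \<eta>. liminf (\<lambda>i. ereal (gromov_product d b (x i) (y i))))"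

text \<open>
  \<open>inverse_power a t\<close> is a to the power -t, with value 0 at t = \<open>\<infinity>\<close>. The value \<open>-\<infinity>\<close> does not
  arise, since Gromov products are non-negative.
\<close>

definition inverse_power :: "real \<Rightarrow> ereal \<Rightarrow> real" where
  "inverse_power a t = (if t = \<infinity> then 0 else a powr (- real_of_ereal t))"

definition visual_metric ::
  "'p set \<Rightarrow> ('p \<Rightarrow> 'p \<Rightarrow> real) \<Rightarrow> ((nat \<Rightarrow> 'p) set \<Rightarrow> (nat \<Rightarrow> 'p) set \<Rightarrow> real) \<Rightarrow> bool" where
  "visual_metric X d D \<longleftrightarrow>
     Metric_space (gromov_boundary X d) D \<and>
     (\<exists>b\<in>X. \<exists>a>1. \<exists>c1>0. \<exists>c2>0. \<forall>\<xi>\<in>gromov_boundary X d. \<forall>\<eta>\<in>gromov_boundary X d.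
        c1 * inverse_power a (boundary_product d b \<xi> \<eta>) \<le> D \<xi> \<eta> \<and>
        D \<xi> \<eta> \<le> c2 * inverse_power a (boundary_product d b \<xi> \<eta>))"

definition uniformly_perfect :: "'z set \<Rightarrow> ('z \<Rightarrow> 'z \<Rightarrow> real) \<Rightarrow> bool" where
  "uniformly_perfect Z D \<longleftrightarrow>
     (\<exists>S>1. \<exists>\<epsilon>\<^sub>0>0. \<forall>x\<in>Z. \<forall>\<epsilon>. 0 < \<epsilon> \<and> \<epsilon> \<le> \<epsilon>\<^sub>0 \<longrightarrow>
        (\<exists>y\<in>Z. \<epsilon> / S < D x y \<and> D x y \<le> \<epsilon>))"

end

theory Submission
  imports Defs
begin

text \<open>
  Fix the base point at the pole and call the distance to it height. If the boundary is uniformly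
  perfect, then, following a ray near a vertex x, one finds arbitrarily many boundary points that
  stay near that ray up to x and have separated from each other a bounded height R later. So x has
  many descendants at height about R above it, whereas by hyperbolicity each vertex has only boundedly
  many ancestors R levels below, with a bound independent of R. Double counting shows that a
  neighbourhood of fixed radius of a finite set A has at least 2|A| elements, hence h > 0.

  Conversely, if the boundary has no point in a long annulus around \<xi>, then because of the pole all
  vertices that are moderately near the corresponding piece of a ray towards \<xi> are uniformly close
  to it. They form a tube whose number of vertices grows with its length, while its vertex boundary
  sits at the two ends, so that a long tube contradicts h > 0.
\<close>

section \<open>Geometric realisation\<close>

text \<open>Apart from rays from the pole no geodesics are used: being close, or being an ancestor,
  is expressed by Gromov products at the base point, so every comparison is a short chain of
  products and costs a fixed multiple of \<delta>. What shapes the first direction is the order of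
  the constants. The bound on ancestors decides how many separated boundary points are wanted, their
  number decides the ratio of separation, and only this ratio decides R; a bound depending on R
  would make the choice circular. In the converse, the tube must not leak sideways. The gap gives a
  self-improvement: a vertex at the right height that is within Q + 2 of the ray is already within Q
  of it, while a step along an edge adds at most 2. Visual metrics enter in two ways. One direction
  receives a metric; the other has to produce one, and a power of the boundary product satisfies the
  triangle inequality only up to a constant. A base close to 1 makes this constant small enough for
  Frink's metrization.\<close>

lemma edge_point_0 [simp]: "edge_point u v 0 = vertex_point u"
  by (simp add: edge_point_def)

lemma edge_point_1 [simp]: "edge_point u v 1 = vertex_point v"
  by (simp add: edge_point_def)

lemma polygonal_path_nonneg: "polygonal_path E p q L \<Longrightarrow> 0 \<le> L"
  by (induction rule: polygonal_path.induct) auto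

lemma polygonal_path_trans:
  assumes "polygonal_path E p q L" and "polygonal_path E q r L'"
  shows "polygonal_path E p r (L + L')"
  using assms
proof (induction rule: polygonal_path.induct)
  case (segment u v s t q L)
  then have "polygonal_path E (edge_point u v s) r (\<bar>s - t\<bar> + (L + L'))"
    by (intro polygonal_path.segment) auto
  then show ?case by (simp add: add.assoc)
qed simp

lemma polygonal_path_edge:
  assumes "(u, v) \<in> E" "0 \<le> s" "s \<le> 1" "0 \<le> t" "t \<le> 1"
  shows "polygonal_path E (edge_point u v s) (edge_point u v t) \<bar>s - t\<bar>"
  using polygonal_path.segment[OF assms polygonal_path.trivial] by simp

lemma polygonal_path_rev: "polygonal_path E p q L \<Longrightarrow> polygonal_path E q p L"
proof (induction rule: polygonal_path.induct)
  case (segment u v s t q L)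
  have "polygonal_path E (edge_point u v t) (edge_point u v s) \<bar>t - s\<bar>"
    using segment by (intro polygonal_path_edge)
  from polygonal_path_trans[OF segment.IH this] show ?case
    by (simp add: abs_minus_commute add.commute)
qed (rule polygonal_path.trivial)

lemma polygonal_path_relpow:
  "(u, w) \<in> E ^^ n \<Longrightarrow> polygonal_path E (vertex_point u) (vertex_point w) (real n)"
proof (induction n arbitrary: w)
  case (Suc n)
  then obtain v where v: "(u, v) \<in> E ^^ n" "(v, w) \<in> E" by auto
  have "polygonal_path E (vertex_point v) (vertex_point w) 1"
    using polygonal_path_edge[OF v(2), of 0 1] by simp
  from polygonal_path_trans[OF Suc.IH[OF v(1)] this] show ?case
    by (simp add: add.commute)
qed (auto intro: polygonal_path.trivial)

text \<open>
  Since points are given in barycentric coordinates, a function on the vertices that varies by at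
  most 1 along edges has an affine extension, which is 1-Lipschitz along polygonal paths.
\<close>

lemma polygonal_path_lipschitz:
  fixes f :: "'a \<Rightarrow> real"
  defines "F \<equiv> \<lambda>p. \<Sum>x | p x \<noteq> 0. p x * f x"
  assumes "polygonal_path E p q L" and "irrefl E"
    and f: "\<And>u v. (u, v) \<in> E \<Longrightarrow> \<bar>f u - f v\<bar> \<le> 1"
  shows "\<bar>F p - F q\<bar> \<le> L"
  using assms(2)
proof (induction rule: polygonal_path.induct)
  case (segment u v s t q L)
  have uv: "u \<noteq> v" using segment(1) \<open>irrefl E\<close> by (auto simp: irrefl_def)
  have F: "F (edge_point u v r) = (1 - r) * f u + r * f v" for r
  proof -
    have "F (edge_point u v r) = (\<Sum>x\<in>{u, v}. edge_point u v r x * f x)"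
      unfolding F_def
      by (rule sum.mono_neutral_left) (auto simp: edge_point_def vertex_point_def indicator_def)
    also have "\<dots> = (1 - r) * f u + r * f v"
      using uv by (simp add: edge_point_def vertex_point_def)
    finally show ?thesis .
  qed
  have "F (edge_point u v s) - F (edge_point u v t) = (s - t) * (f v - f u)"
    by (simp add: F algebra_simps)
  then have "\<bar>F (edge_point u v s) - F (edge_point u v t)\<bar> = \<bar>s - t\<bar> * \<bar>f v - f u\<bar>"
    by (simp add: abs_mult)
  also have "\<dots> \<le> \<bar>s - t\<bar> * 1"
    using f[OF segment(1)] by (intro mult_left_mono) (auto simp: abs_minus_commute)
  finally have "\<bar>F (edge_point u v s) - F (edge_point u v t)\<bar> \<le> \<bar>s - t\<bar>" by simp
  with segment.IH show ?case
    using abs_triangle_ineq[of "F (edge_point u v s) - F (edge_point u v t)"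
        "F (edge_point u v t) - F q"] by simp
qed simp

section \<open>The length metric of a connected graph\<close>

locale graph =
  fixes V :: "'a set" and E :: "('a \<times> 'a) set"
  assumes conn: "connected_graph V E"
begin

abbreviation "X \<equiv> graph_points V E"
abbreviation "d \<equiv> graph_dist E"

lemma symE: "sym E" and irreflE: "irrefl E" and EV: "E \<subseteq> V \<times> V" and V_ne: "V \<noteq> {}"
  and reach: "u \<in> V \<Longrightarrow> v \<in> V \<Longrightarrow> (u, v) \<in> E\<^sup>*"
  using conn by (auto simp: connected_graph_def simple_graph_def)

lemma near_vertex:
  assumes "p \<in> X"
  obtains u L where "u \<in> V" "polygonal_path E p (vertex_point u) L" "L \<le> 1"
proof -
  from assms consider u where "u \<in> V" "p = vertex_point u"
    | u v t where "(u, v) \<in> E" "0 \<le> t" "t \<le> 1" "p = edge_point u v t"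
    by (auto simp: graph_points_def)
  then show ?thesis
  proof cases
    case 1
    then show ?thesis using that[of u 0] by (auto intro: polygonal_path.trivial)
  next
    case 2
    then show ?thesis using that[of u t] polygonal_path_edge[of u v E t 0] EV by auto
  qed
qed

lemma vertex_in_points: "u \<in> V \<Longrightarrow> vertex_point u \<in> X"
  by (auto simp: graph_points_def)

lemma path_exists:
  assumes "p \<in> X" "q \<in> X"
  shows "\<exists>L. polygonal_path E p q L"
proof -
  obtain u L where u: "u \<in> V" "polygonal_path E p (vertex_point u) L"
    using near_vertex[OF assms(1)] by metis
  obtain w L' where w: "w \<in> V" "polygonal_path E q (vertex_point w) L'"
    using near_vertex[OF assms(2)] by metis
  obtain n where "(u, w) \<in> E ^^ n"
    using reach[OF u(1) w(1)] by (auto simp: rtrancl_power)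
  from polygonal_path_trans[OF polygonal_path_trans[OF u(2) polygonal_path_relpow[OF this]]
      polygonal_path_rev[OF w(2)]]
  show ?thesis by blast
qed

lemma dist_le: "polygonal_path E p q L \<Longrightarrow> d p q \<le> L"
  unfolding graph_dist_def
  by (rule cInf_lower) (auto intro!: bdd_belowI[of _ 0] polygonal_path_nonneg)

text \<open>A real infimum respects lower bounds only over a non-empty set; this is where
  connectedness enters, through \<open>path_exists\<close>.\<close>

lemma dist_ge:
  assumes "p \<in> X" "q \<in> X" "\<And>L. polygonal_path E p q L \<Longrightarrow> c \<le> L"
  shows "c \<le> d p q"
  unfolding graph_dist_def using path_exists[OF assms(1,2)] assms(3)
  by (intro cInf_greatest) auto

lemma dist_nonneg: "p \<in> X \<Longrightarrow> q \<in> X \<Longrightarrow> 0 \<le> d p q"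
  by (rule dist_ge) (auto intro: polygonal_path_nonneg)

lemma dist_refl: "p \<in> X \<Longrightarrow> d p p = 0"
  using dist_le[OF polygonal_path.trivial] dist_nonneg by (metis antisym)

lemma dist_sym: "d p q = d q p"
proof -
  have "{L. polygonal_path E p q L} = {L. polygonal_path E q p L}"
    by (auto intro: polygonal_path_rev)
  then show ?thesis by (simp add: graph_dist_def)
qed

lemma dist_triangle:
  assumes "p \<in> X" "q \<in> X" "r \<in> X"
  shows "d p r \<le> d p q + d q r"
proof -
  have "d p r - L \<le> d q r" if "polygonal_path E p q L" for L
    using assms dist_le[OF polygonal_path_trans[OF that]]
    by (intro dist_ge) (auto simp: algebra_simps)
  then have "d p r - d q r \<le> d p q"
    using assms by (intro dist_ge) (auto simp: algebra_simps)
  then show ?thesis by simp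
qed

lemma dense: "p \<in> X \<Longrightarrow> \<exists>v\<in>V. d p (vertex_point v) \<le> 1"
  by (metis near_vertex dist_le order_trans)

section \<open>Combinatorial distance between vertices\<close>

definition hops :: "'a \<Rightarrow> 'a \<Rightarrow> nat" where
  "hops u w = (LEAST n. (u, w) \<in> E ^^ n)"

lemma hops: "u \<in> V \<Longrightarrow> w \<in> V \<Longrightarrow> (u, w) \<in> E ^^ hops u w"
  unfolding hops_def using reach by (metis LeastI rtrancl_imp_relpow)

lemma hops_le: "(u, w) \<in> E ^^ n \<Longrightarrow> hops u w \<le> n"
  unfolding hops_def by (rule Least_le)

lemma hops_edge:
  assumes "(u, v) \<in> E" "w \<in> V"
  shows "hops u w \<le> Suc (hops v w)"
proof -
  have "v \<in> V" using assms EV by auto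
  then show ?thesis using hops_le relpow_Suc_I2[OF assms(1) hops] assms(2) by blast
qed

text \<open>A shortest edge path gives one inequality. For the other, the number of hops to
  \<open>w\<close> changes by at most 1 along an edge, so its affine extension bounds the length of
  every polygonal path from below, including paths that turn round inside an edge.\<close>

lemma dist_vertex:
  assumes "u \<in> V" "w \<in> V"
  shows "d (vertex_point u) (vertex_point w) = real (hops u w)"
proof (rule antisym)
  show "d (vertex_point u) (vertex_point w) \<le> real (hops u w)"
    by (intro dist_le polygonal_path_relpow hops assms)
  define f where "f = (\<lambda>x. real (hops x w))"
  have f: "\<bar>f u - f v\<bar> \<le> 1" if "(u, v) \<in> E" for u v
    using hops_edge[OF that assms(2)] hops_edge[OF symD[OF symE that] assms(2)]
    by (simp add: f_def)
  have vp: "(\<Sum>y | vertex_point x y \<noteq> 0. vertex_point x y * f y) = f x" for x :: 'a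
    by (simp add: vertex_point_def indicator_def)
  have "hops w w = 0" using hops_le[of w w 0] by simp
  then have "f u \<le> L" if "polygonal_path E (vertex_point u) (vertex_point w) L" for L
    using polygonal_path_lipschitz[where f = f, OF that irreflE f] unfolding vp
    by (simp add: f_def)
  then show "real (hops u w) \<le> d (vertex_point u) (vertex_point w)"
    by (intro dist_ge vertex_in_points assms) (simp add: f_def)
qed

lemma hops_eq_0: "u \<in> V \<Longrightarrow> w \<in> V \<Longrightarrow> hops u w = 0 \<longleftrightarrow> u = w"
  using hops[of u w] hops_le[of w w 0] by auto

section \<open>Vertex boundaries and sizes of balls\<close>

lemma vertex_boundary_eq:
  assumes "A \<subseteq> V" "A \<noteq> {}" "finite A"
  shows "vertex_boundary V E A =
    {y \<in> V - A. \<exists>x\<in>A. d (vertex_point x) (vertex_point y) \<le> 1}"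
proof -
  have "(INF a\<in>A. d (vertex_point y) (vertex_point a)) = 1 \<longleftrightarrow>
      y \<notin> A \<and> (\<exists>x\<in>A. d (vertex_point x) (vertex_point y) \<le> 1)" if y: "y \<in> V" for y
  proof -
    define f where "f = (\<lambda>a. d (vertex_point y) (vertex_point a))"
    have f: "f a = real (hops y a)" if "a \<in> A" for a
      using assms y that by (auto simp: f_def dist_vertex)
    have "(INF a\<in>A. f a) = Min (f ` A)"
      using assms by (simp add: cInf_eq_Min)
    moreover have "Min (f ` A) = 1 \<longleftrightarrow> (1 \<in> f ` A \<and> (\<forall>a\<in>A. 1 \<le> f a))"
      using assms by (subst Min_eq_iff) auto
    moreover have "1 \<le> f a \<longleftrightarrow> a \<noteq> y" if "a \<in> A" for a
      using hops_eq_0[of y a] f[OF that] that assms y by auto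
    moreover have "1 \<in> f ` A \<longleftrightarrow> (\<exists>a\<in>A. f a \<le> 1)" if "y \<notin> A"
    proof
      assume "\<exists>a\<in>A. f a \<le> 1"
      then obtain a where a: "a \<in> A" "f a \<le> 1" by blast
      moreover have "1 \<le> f a" using calculation that assms y
          hops_eq_0[of y a] f[of a] by auto
      ultimately show "1 \<in> f ` A" by (metis antisym image_eqI)
    qed force
    moreover have "d (vertex_point a) (vertex_point y) = f a" for a
      by (simp add: f_def dist_sym)
    ultimately show ?thesis unfolding f_def[symmetric] by auto
  qed
  then show ?thesis by (auto simp: vertex_boundary_def)
qed

text \<open>The first step out of \<open>A\<close> lands on a boundary vertex, and what remains of
  the path is no longer than the whole. In this way expansion at a fixed radius is later charged to
  the boundary.\<close>

lemma path_leaves_through_neighbour: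
  assumes "(x, y) \<in> E ^^ n" "x \<in> A" "y \<in> V - A" "A \<subseteq> V"
  shows "\<exists>b\<in>V - A. (\<exists>a\<in>A. (a, b) \<in> E) \<and> (\<exists>m\<le>n. (b, y) \<in> E ^^ m)"
  using assms(1,2)
proof (induction n arbitrary: x)
  case 0
  then show ?case using assms by auto
next
  case (Suc n)
  then obtain z where z: "(x, z) \<in> E" "(z, y) \<in> E ^^ n" by (metis relpow_Suc_D2)
  show ?case
  proof (cases "z \<in> A")
    case True
    then show ?thesis using Suc.IH[OF z(2)] by (meson le_SucI)
  next
    case False
    moreover have "n \<le> Suc n" by simp
    ultimately show ?thesis using z EV Suc.prems(2) by blast
  qed
qed

lemma bounded_balls:
  assumes "uniform_graph V E"
  obtains N :: "real \<Rightarrow> nat" where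
    "\<And>R p. p \<in> X \<Longrightarrow> finite {w \<in> V. d p (vertex_point w) \<le> R} \<and>
      card {w \<in> V. d p (vertex_point w) \<le> R} \<le> N R"
proof -
  obtain \<mu> where mu: "\<And>v. v \<in> V \<Longrightarrow> finite (E `` {v}) \<and> card (E `` {v}) \<le> \<mu>"
    using assms by (auto simp: uniform_graph_def)
  define S where "S u k = {w \<in> V. \<exists>n\<le>k. (u, w) \<in> E ^^ n}" for u and k :: nat
  have S: "finite (S u k) \<and> card (S u k) \<le> (1 + \<mu>) ^ k" if u: "u \<in> V" for u k
  proof (induction k)
    case 0
    have "S u 0 = {u}" using u by (auto simp: S_def)
    then show ?case by simp
  next
    case (Suc k)
    have "S u (Suc k) \<subseteq> S u k \<union> (\<Union>v\<in>S u k. E `` {v})"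
    proof
      fix w assume "w \<in> S u (Suc k)"
      then obtain n where w: "w \<in> V" "n \<le> Suc k" "(u, w) \<in> E ^^ n" by (auto simp: S_def)
      show "w \<in> S u k \<union> (\<Union>v\<in>S u k. E `` {v})"
      proof (cases "n \<le> k")
        case False
        then have "(u, w) \<in> E ^^ Suc k" using w by (metis le_SucE)
        then obtain v where "(u, v) \<in> E ^^ k" "(v, w) \<in> E" by auto
        then have "v \<in> S u k" "w \<in> E `` {v}" using EV by (auto simp: S_def)
        then show ?thesis by blast
      qed (use w in \<open>auto simp: S_def\<close>)
    qed
    moreover have fin: "finite (S u k \<union> (\<Union>v\<in>S u k. E `` {v}))"
      using Suc.IH mu by (auto simp: S_def)
    ultimately have "finite (S u (Suc k))"
      and "card (S u (Suc k)) \<le> card (S u k \<union> (\<Union>v\<in>S u k. E `` {v}))"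
      by (auto intro: finite_subset card_mono)
    moreover have "card (S u k \<union> (\<Union>v\<in>S u k. E `` {v})) \<le>
        card (S u k) + (\<Sum>v\<in>S u k. card (E `` {v}))"
      using card_Un_le card_UN_le[of "S u k" "\<lambda>v. E `` {v}"] Suc.IH
      by (meson add_left_mono order_trans)
    moreover have "(\<Sum>v\<in>S u k. card (E `` {v})) \<le> card (S u k) * \<mu>"
      using sum_bounded_above[of "S u k" "\<lambda>v. card (E `` {v})" \<mu>] mu by (auto simp: S_def)
    moreover have "card (S u k) * (1 + \<mu>) \<le> (1 + \<mu>) ^ k * (1 + \<mu>)"
      using Suc.IH by (intro mult_right_mono) auto
    ultimately show ?case by (auto simp: algebra_simps)
  qed
  \<comment> \<open>The summand 1 pays for replacing the centre \<open>p\<close> by a vertex at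
    distance at most 1.\<close>
  define N where "N R = (1 + \<mu>) ^ nat \<lceil>R + 1\<rceil>" for R :: real
  have "finite {w \<in> V. d p (vertex_point w) \<le> R} \<and>
      card {w \<in> V. d p (vertex_point w) \<le> R} \<le> N R" if p: "p \<in> X" for R p
  proof -
    obtain u where u: "u \<in> V" "d p (vertex_point u) \<le> 1" using dense[OF p] by blast
    have "{w \<in> V. d p (vertex_point w) \<le> R} \<subseteq> S u (nat \<lceil>R + 1\<rceil>)"
    proof safe
      fix w assume w: "w \<in> V" "d p (vertex_point w) \<le> R"
      have "real (hops u w) \<le> d (vertex_point u) p + d p (vertex_point w)"
        using dist_triangle[of "vertex_point u" p "vertex_point w"] u w p
        by (simp add: dist_vertex vertex_in_points)
      then have "real (hops u w) \<le> R + 1" using u w by (simp add: dist_sym)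
      then have "hops u w \<le> nat \<lceil>R + 1\<rceil>" by linarith
      then show "w \<in> S u (nat \<lceil>R + 1\<rceil>)" using hops[OF u(1) w(1)] w by (auto simp: S_def)
    qed
    then show ?thesis using S[OF u(1)] unfolding N_def
      by (meson card_mono finite_subset order_trans)
  qed
  then show ?thesis using that by blast
qed

end

section \<open>Gromov boundary\<close>

locale hyperbolic_space =
  fixes X :: "'p set" and d :: "'p \<Rightarrow> 'p \<Rightarrow> real" and \<delta> :: real
  assumes refl: "x \<in> X \<Longrightarrow> d x x = 0"
    and sym: "x \<in> X \<Longrightarrow> y \<in> X \<Longrightarrow> d x y = d y x"
    and tri: "x \<in> X \<Longrightarrow> y \<in> X \<Longrightarrow> z \<in> X \<Longrightarrow> d x z \<le> d x y + d y z"
    and delta: "0 \<le> \<delta>"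
    and hyp: "\<lbrakk>x \<in> X; y \<in> X; z \<in> X; b \<in> X\<rbrakk> \<Longrightarrow>
      gromov_product d b x y \<ge> min (gromov_product d b x z) (gromov_product d b z y) - \<delta>"
begin

abbreviation "gp \<equiv> gromov_product d"
abbreviation "bp \<equiv> boundary_product d"
abbreviation "bd \<equiv> gromov_boundary X d"

lemma nonneg: "x \<in> X \<Longrightarrow> y \<in> X \<Longrightarrow> 0 \<le> d x y"
  using tri[of x y x] refl[of x] sym[of x y] by simp

lemma gp_sym: "x \<in> X \<Longrightarrow> y \<in> X \<Longrightarrow> gp b x y = gp b y x"
  using sym by (simp add: gromov_product_def)

lemma gp_nonneg: "x \<in> X \<Longrightarrow> y \<in> X \<Longrightarrow> b \<in> X \<Longrightarrow> 0 \<le> gp b x y"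
  using tri[of x b y] sym[of b y] by (simp add: gromov_product_def)

lemma gp_le: "x \<in> X \<Longrightarrow> y \<in> X \<Longrightarrow> b \<in> X \<Longrightarrow> gp b x y \<le> d x b"
  using tri[of y x b] sym[of x y] by (simp add: gromov_product_def)

lemma gp_lipschitz:
  "x \<in> X \<Longrightarrow> y \<in> X \<Longrightarrow> z \<in> X \<Longrightarrow> b \<in> X \<Longrightarrow> gp b x y - d y z \<le> gp b x z"
  using tri[of y z b] tri[of x y z] by (simp add: gromov_product_def field_simps)

lemma gp_base:
  "x \<in> X \<Longrightarrow> y \<in> X \<Longrightarrow> b \<in> X \<Longrightarrow> c \<in> X \<Longrightarrow> gp b x y - d b c \<le> gp c x y"
  using tri[of x c b] tri[of y c b] sym[of b c] by (simp add: gromov_product_def field_simps)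

lemma dist_eq_gp: "d x y = d x b + d y b - 2 * gp b x y"
  by (simp add: gromov_product_def field_simps)

lemma hyp_trans:
  assumes "r \<le> gp b x y" "r \<le> gp b y z" "x \<in> X" "y \<in> X" "z \<in> X" "b \<in> X"
  shows "r - \<delta> \<le> gp b x z"
  using hyp[of x z y b] assms by linarith

lemma hyp_trans3:
  assumes "r \<le> gp b x y" "r \<le> gp b y z" "r \<le> gp b z w"
    and "x \<in> X" "y \<in> X" "z \<in> X" "w \<in> X" "b \<in> X"
  shows "r - 2 * \<delta> \<le> gp b x w"
  using hyp_trans[of r b x y z] hyp_trans[of "r - \<delta>" b x z w] assms delta by simp

text \<open>Moving the base point from \<open>b\<close> to \<open>c\<close> lowers a product by at
  most \<open>d b c\<close>, so the condition at one base point gives it at all of them. The product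
  filter becomes one threshold for both indices.\<close>

lemma conv_iff:
  assumes "b \<in> X"
  shows "converges_to_infinity X d x \<longleftrightarrow>
    range x \<subseteq> X \<and> (\<forall>r. \<exists>N. \<forall>i\<ge>N. \<forall>j\<ge>N. r \<le> gp b (x i) (x j))" (is "_ \<longleftrightarrow> _ \<and> ?P b")
proof -
  have eq: "filterlim (\<lambda>(i, j). gp c (x i) (x j)) at_top (sequentially \<times>\<^sub>F sequentially) \<longleftrightarrow> ?P c"
    for c
    by (simp add: filterlim_at_top eventually_prod_sequentially) meson
  have "?P c" if "c \<in> X" "range x \<subseteq> X" "?P b" for c
  proof
    fix r
    obtain N where "\<forall>i\<ge>N. \<forall>j\<ge>N. r + d b c \<le> gp b (x i) (x j)" using \<open>?P b\<close> by blast
    then have "r \<le> gp c (x i) (x j)" if "i \<ge> N" "j \<ge> N" for i j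
      using gp_base[of "x i" "x j" b c] that \<open>range x \<subseteq> X\<close> \<open>c \<in> X\<close> assms
      by (smt (verit) range_subsetD)
    then show "\<exists>N. \<forall>i\<ge>N. \<forall>j\<ge>N. r \<le> gp c (x i) (x j)" by blast
  qed
  then show ?thesis unfolding converges_to_infinity_def eq using assms by blast
qed

lemma conv_in: "converges_to_infinity X d x \<Longrightarrow> x i \<in> X"
  by (auto simp: converges_to_infinity_def)

lemma conv_gp:
  "converges_to_infinity X d x \<Longrightarrow> b \<in> X \<Longrightarrow> \<exists>N. \<forall>i\<ge>N. \<forall>j\<ge>N. r \<le> gp b (x i) (x j)"
  using conv_iff by blast

lemma equiv_iff:
  assumes "b \<in> X"
  shows "(x, y) \<in> boundary_equiv X d \<longleftrightarrow>
    converges_to_infinity X d x \<and> converges_to_infinity X d y \<and>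
    (\<forall>r. \<forall>\<^sub>F i in sequentially. r \<le> gp b (x i) (y i))"
    (is "_ \<longleftrightarrow> ?x \<and> ?y \<and> ?P b")
proof -
  have "?P c" if "c \<in> X" ?x ?y "?P b" for c
  proof
    fix r
    show "\<forall>\<^sub>F i in sequentially. r \<le> gp c (x i) (y i)"
      using \<open>?P b\<close>[rule_format, of "r + d b c"]
    proof (rule eventually_mono)
      fix i assume "r + d b c \<le> gp b (x i) (y i)"
      then show "r \<le> gp c (x i) (y i)"
        using gp_base[of "x i" "y i" b c] conv_in that assms by fastforce
    qed
  qed
  then show ?thesis unfolding boundary_equiv_def filterlim_at_top using assms by blast
qed

text \<open>Equivalence compares equal indices only; convergence of \<open>y\<close> and one use of
  hyperbolicity free the second index. This permits the change of representatives in
  \<open>bp_ge\<close>.\<close>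

lemma equiv_gp:
  assumes "(x, y) \<in> boundary_equiv X d" "b \<in> X"
  shows "\<exists>N. \<forall>i\<ge>N. \<forall>j\<ge>N. r \<le> gp b (x i) (y j)"
proof -
  have c: "converges_to_infinity X d x" "converges_to_infinity X d y"
    using assms by (auto simp: boundary_equiv_def)
  obtain N1 where N1: "\<forall>i\<ge>N1. r + \<delta> \<le> gp b (x i) (y i)"
    using assms equiv_iff[OF assms(2), of x y] by (auto simp: eventually_sequentially)
  obtain N2 where N2: "\<forall>i\<ge>N2. \<forall>j\<ge>N2. r + \<delta> \<le> gp b (y i) (y j)"
    using conv_gp[OF c(2) assms(2)] by blast
  have "r \<le> gp b (x i) (y j)" if "i \<ge> max N1 N2" "j \<ge> max N1 N2" for i j
    using hyp_trans[of "r + \<delta>" b "x i" "y i" "y j"] N1 N2 that conv_in c assms by auto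
  then show ?thesis by blast
qed

lemma boundary_equiv: "equiv {x. converges_to_infinity X d x} (boundary_equiv X d)"
proof (cases "X = {}")
  case True
  then have "\<not> converges_to_infinity X d x" for x by (auto simp: converges_to_infinity_def)
  then show ?thesis by (auto simp: equiv_def refl_on_def sym_on_def trans_on_def boundary_equiv_def)
next
  case False
  then obtain b where b: "b \<in> X" by blast
  show ?thesis
  proof (rule equivI)
    show "boundary_equiv X d \<subseteq> {x. converges_to_infinity X d x} \<times> {x. converges_to_infinity X d x}"
      by (auto simp: boundary_equiv_def)
    show "refl_on {x. converges_to_infinity X d x} (boundary_equiv X d)"
    proof (rule refl_onI)
      fix x assume "x \<in> {x. converges_to_infinity X d x}"
      then have x: "converges_to_infinity X d x" by simp
      have "\<forall>\<^sub>F i in sequentially. r \<le> gp b (x i) (x i)" for r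
        using conv_gp[OF x b, of r] by (auto simp: eventually_sequentially)
      then show "(x, x) \<in> boundary_equiv X d" using x by (simp add: equiv_iff[OF b])
    qed
    show "Relation.sym (boundary_equiv X d)"
    proof (rule symI)
      fix x y assume xy: "(x, y) \<in> boundary_equiv X d"
      then have c: "converges_to_infinity X d x" "converges_to_infinity X d y"
        by (auto simp: boundary_equiv_def)
      then have "gp b (x i) (y i) = gp b (y i) (x i)" for i by (simp add: gp_sym conv_in)
      then show "(y, x) \<in> boundary_equiv X d" using xy by (simp add: equiv_iff[OF b])
    qed
    show "trans (boundary_equiv X d)"
    proof (rule transI)
      fix x y z assume xy: "(x, y) \<in> boundary_equiv X d" and yz: "(y, z) \<in> boundary_equiv X d"
      have c: "converges_to_infinity X d x" "converges_to_infinity X d y"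
        "converges_to_infinity X d z"
        using xy yz by (auto simp: boundary_equiv_def)
      have "\<forall>\<^sub>F i in sequentially. r \<le> gp b (x i) (z i)" for r
      proof -
        have "\<forall>\<^sub>F i in sequentially. r + \<delta> \<le> gp b (x i) (y i) \<and> r + \<delta> \<le> gp b (y i) (z i)"
          using xy yz by (auto simp: equiv_iff[OF b] intro: eventually_conj)
        then show ?thesis
        proof (rule eventually_mono)
          fix i assume "r + \<delta> \<le> gp b (x i) (y i) \<and> r + \<delta> \<le> gp b (y i) (z i)"
          then show "r \<le> gp b (x i) (z i)"
            using hyp_trans[of "r + \<delta>" b "x i" "y i" "z i"] c b by (simp add: conv_in)
        qed
      qed
      then show "(x, z) \<in> boundary_equiv X d" using c by (simp add: equiv_iff[OF b])
    qed
  qed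
qed

section \<open>Boundary points and their Gromov product\<close>

lemma bd_nonempty: "\<xi> \<in> bd \<Longrightarrow> \<exists>x. x \<in> \<xi>"
  unfolding gromov_boundary_def using in_quotient_imp_non_empty[OF boundary_equiv] by blast

lemma bd_conv: "\<xi> \<in> bd \<Longrightarrow> x \<in> \<xi> \<Longrightarrow> converges_to_infinity X d x"
  unfolding gromov_boundary_def using in_quotient_imp_subset[OF boundary_equiv] by blast

lemma bd_equiv: "\<xi> \<in> bd \<Longrightarrow> x \<in> \<xi> \<Longrightarrow> y \<in> \<xi> \<Longrightarrow> (x, y) \<in> boundary_equiv X d"
  unfolding gromov_boundary_def using in_quotient_imp_in_rel[OF boundary_equiv] by blast

lemma bd_in: "\<xi> \<in> bd \<Longrightarrow> x \<in> \<xi> \<Longrightarrow> x i \<in> X"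
  using bd_conv conv_in by blast

lemma bd_eqI:
  "\<xi> \<in> bd \<Longrightarrow> \<eta> \<in> bd \<Longrightarrow> x \<in> \<xi> \<Longrightarrow> y \<in> \<eta> \<Longrightarrow> (x, y) \<in> boundary_equiv X d \<Longrightarrow> \<xi> = \<eta>"
  unfolding gromov_boundary_def using quotient_eqI[OF boundary_equiv] by blast

lemma conv_bd:
  assumes "converges_to_infinity X d x"
  shows "boundary_equiv X d `` {x} \<in> bd" "x \<in> boundary_equiv X d `` {x}"
  using assms equiv_class_self[OF boundary_equiv] by (auto simp: gromov_boundary_def quotientI)

text \<open>A liminf of at least r forces the terms only above numbers strictly below r. Later uses
  take r - 1, which is the origin of many summands 1 in the constants.\<close>

lemma bp_eventually:
  assumes "ereal r \<le> bp b \<xi> \<eta>" "x \<in> \<xi>" "y \<in> \<eta>" "r' < r"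
  shows "\<forall>\<^sub>F i in sequentially. r' \<le> gp b (x i) (y i)"
proof -
  have "bp b \<xi> \<eta> \<le> liminf (\<lambda>i. ereal (gp b (x i) (y i)))"
    unfolding boundary_product_def using assms by (intro INF_lower2[of "(x, y)"]) auto
  then have "ereal r' < liminf (\<lambda>i. ereal (gp b (x i) (y i)))"
    using assms by (metis less_ereal.simps(1) less_le_trans)
  from less_LiminfD[OF this] show ?thesis by (auto elim: eventually_mono)
qed

text \<open>One far index \<open>k\<close> with a large product is enough: for any other
  representatives the points \<open>x' i\<close>, \<open>x k\<close>, \<open>y k\<close>,
  \<open>y' i\<close> form a chain of three large products, and \<open>hyp_trans3\<close> costs
  2\<delta>. So passing to the infimum over all representatives loses no more than this.\<close>

lemma bp_ge:
  assumes "\<xi> \<in> bd" "\<eta> \<in> bd" "x \<in> \<xi>" "y \<in> \<eta>" "b \<in> X"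
    and freq: "\<exists>\<^sub>F i in sequentially. r \<le> gp b (x i) (y i)"
  shows "ereal (r - 2 * \<delta>) \<le> bp b \<xi> \<eta>"
  unfolding boundary_product_def
proof (rule INF_greatest, clarify)
  fix x' y' assume x': "x' \<in> \<xi>" and y': "y' \<in> \<eta>"
  obtain N1 where N1: "\<forall>i\<ge>N1. \<forall>j\<ge>N1. r \<le> gp b (x' i) (x j)"
    using equiv_gp[OF bd_equiv[OF assms(1) x' assms(3)] assms(5)] by blast
  obtain N2 where N2: "\<forall>i\<ge>N2. \<forall>j\<ge>N2. r \<le> gp b (y i) (y' j)"
    using equiv_gp[OF bd_equiv[OF assms(2) assms(4) y'] assms(5)] by blast
  obtain k where k: "k \<ge> max N1 N2" "r \<le> gp b (x k) (y k)"
    using freq unfolding frequently_sequentially by blast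
  have "r - 2 * \<delta> \<le> gp b (x' i) (y' i)" if "i \<ge> max N1 N2" for i
    using hyp_trans3[of r b "x' i" "x k" "y k" "y' i"] N1 N2 k that assms x' y'
    by (auto simp: bd_in)
  then have "\<forall>\<^sub>F i in sequentially. r - 2 * \<delta> \<le> gp b (x' i) (y' i)"
    unfolding eventually_sequentially by blast
  then show "ereal (r - 2 * \<delta>) \<le> liminf (\<lambda>i. ereal (gp b (x' i) (y' i)))"
    by (intro Liminf_bounded) (auto elim: eventually_mono)
qed

lemma bp_sym:
  assumes "\<xi> \<in> bd" "\<eta> \<in> bd"
  shows "bp b \<xi> \<eta> = bp b \<eta> \<xi>"
proof -
  have le: "bp b \<xi> \<eta> \<le> bp b \<eta> \<xi>" if "\<xi> \<in> bd" "\<eta> \<in> bd" for \<xi> \<eta>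
  proof -
    have "bp b \<xi> \<eta> \<le> liminf (\<lambda>i. ereal (gp b (y i) (x i)))" if "y \<in> \<eta>" "x \<in> \<xi>" for x y
    proof -
      have "gp b (y i) (x i) = gp b (x i) (y i)" for i
        using that \<open>\<xi> \<in> bd\<close> \<open>\<eta> \<in> bd\<close> by (simp add: gp_sym bd_in)
      then show ?thesis unfolding boundary_product_def
        using that by (intro INF_lower2[of "(x, y)"]) auto
    qed
    then show ?thesis
      by (subst (2) boundary_product_def) (auto intro!: INF_greatest)
  qed
  show ?thesis using le assms by (metis antisym)
qed

lemma bp_nonneg:
  assumes "\<xi> \<in> bd" "\<eta> \<in> bd" "b \<in> X"
  shows "0 \<le> bp b \<xi> \<eta>"
  unfolding boundary_product_def
  by (rule INF_greatest, clarify, rule Liminf_bounded)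
    (use assms in \<open>auto simp: gp_nonneg bd_in zero_ereal_def\<close>)

lemma bp_infinite_iff:
  assumes "\<xi> \<in> bd" "\<eta> \<in> bd" "b \<in> X"
  shows "bp b \<xi> \<eta> = \<infinity> \<longleftrightarrow> \<xi> = \<eta>"
proof
  assume inf: "bp b \<xi> \<eta> = \<infinity>"
  obtain x y where xy: "x \<in> \<xi>" "y \<in> \<eta>" using assms bd_nonempty by blast
  have "\<forall>\<^sub>F i in sequentially. r \<le> gp b (x i) (y i)" for r
    using bp_eventually[of "r + 1" b \<xi> \<eta> x y r] inf xy by simp
  then have "(x, y) \<in> boundary_equiv X d"
    using bd_conv assms xy by (simp add: equiv_iff[OF assms(3)])
  then show "\<xi> = \<eta>" using bd_eqI assms xy by blast
next
  assume eq: "\<xi> = \<eta>"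
  obtain x where x: "x \<in> \<xi>" using assms bd_nonempty by blast
  have "ereal r \<le> bp b \<xi> \<eta>" for r
  proof -
    have "\<forall>\<^sub>F i in sequentially. r + 2 * \<delta> \<le> gp b (x i) (x i)"
      using bd_equiv[OF assms(1) x x] by (simp add: equiv_iff[OF assms(3)])
    then show ?thesis
      using bp_ge[OF assms(1,2) x _ assms(3), of x "r + 2 * \<delta>"] eq x
      by (simp add: eventually_frequently)
  qed
  then show "bp b \<xi> \<eta> = \<infinity>" by (meson ereal_top)
qed

text \<open>The loss is 1 from \<open>bp_eventually\<close>, \<delta> from \<open>hyp_trans\<close>
  and 2\<delta> from \<open>bp_ge\<close>. It becomes the exponent of the constant \<open>K\<close>
  when a visual metric is built.\<close>

lemma bp_hyp:
  assumes "\<xi> \<in> bd" "\<eta> \<in> bd" "\<zeta> \<in> bd" "b \<in> X"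
    and "ereal r \<le> bp b \<xi> \<eta>" "ereal r \<le> bp b \<eta> \<zeta>"
  shows "ereal (r - (3 * \<delta> + 1)) \<le> bp b \<xi> \<zeta>"
proof -
  obtain x y z where xyz: "x \<in> \<xi>" "y \<in> \<eta>" "z \<in> \<zeta>" using assms bd_nonempty by metis
  have "\<forall>\<^sub>F i in sequentially. r - 1 \<le> gp b (x i) (y i) \<and> r - 1 \<le> gp b (y i) (z i)"
    using assms xyz by (intro eventually_conj bp_eventually) auto
  then have "\<forall>\<^sub>F i in sequentially. r - 1 - \<delta> \<le> gp b (x i) (z i)"
    by (rule eventually_mono) (use assms xyz in \<open>auto intro!: hyp_trans intro: bd_in\<close>)
  then have "ereal (r - 1 - \<delta> - 2 * \<delta>) \<le> bp b \<xi> \<zeta>"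
    using assms xyz by (intro bp_ge) (auto simp: eventually_frequently)
  then show ?thesis by (simp add: algebra_simps)
qed

lemma bp_base:
  assumes "\<xi> \<in> bd" "\<eta> \<in> bd" "b \<in> X" "c \<in> X" "ereal r \<le> bp b \<xi> \<eta>"
  shows "ereal (r - (d b c + 2 * \<delta> + 1)) \<le> bp c \<xi> \<eta>"
proof -
  obtain x y where xy: "x \<in> \<xi>" "y \<in> \<eta>" using assms bd_nonempty by metis
  have "\<forall>\<^sub>F i in sequentially. r - 1 \<le> gp b (x i) (y i)"
    using assms xy by (intro bp_eventually) auto
  then have "\<forall>\<^sub>F i in sequentially. r - 1 - d b c \<le> gp c (x i) (y i)"
  proof (rule eventually_mono)
    fix i assume "r - 1 \<le> gp b (x i) (y i)"
    then show "r - 1 - d b c \<le> gp c (x i) (y i)"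
      using gp_base[of "x i" "y i" b c] assms xy by (auto simp: bd_in)
  qed
  then have "ereal (r - 1 - d b c - 2 * \<delta>) \<le> bp c \<xi> \<eta>"
    using assms xy by (intro bp_ge) (auto simp: eventually_frequently)
  then show ?thesis by (simp add: algebra_simps)
qed

end

section \<open>Visual metrics\<close>

inductive chain :: "('z \<Rightarrow> 'z \<Rightarrow> real) \<Rightarrow> 'z set \<Rightarrow> nat \<Rightarrow> 'z \<Rightarrow> 'z \<Rightarrow> real \<Rightarrow> bool"
  for \<rho> Z where
  chain_0: "x \<in> Z \<Longrightarrow> chain \<rho> Z 0 x x 0"
| chain_Suc: "x \<in> Z \<Longrightarrow> chain \<rho> Z n y z s \<Longrightarrow> chain \<rho> Z (Suc n) x z (\<rho> x y + s)"

lemma chain_in: "chain \<rho> Z n x y s \<Longrightarrow> x \<in> Z \<and> y \<in> Z"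
  by (induction rule: chain.induct) auto

lemma chain_0D: "chain \<rho> Z 0 x y s \<Longrightarrow> x = y \<and> s = 0"
  by (erule chain.cases) simp_all

lemma chain_trans:
  "chain \<rho> Z n x y s \<Longrightarrow> chain \<rho> Z m y z t \<Longrightarrow> chain \<rho> Z (n + m) x z (s + t)"
  by (induction rule: chain.induct) (auto simp: add.assoc intro: chain_Suc)

lemma chain_single: "x \<in> Z \<Longrightarrow> y \<in> Z \<Longrightarrow> chain \<rho> Z 1 x y (\<rho> x y)"
  using chain_Suc[OF _ chain_0, of x Z y \<rho>] by simp

lemma chain_rev:
  assumes "\<And>x y. x \<in> Z \<Longrightarrow> y \<in> Z \<Longrightarrow> \<rho> x y = \<rho> y x"
  shows "chain \<rho> Z n x y s \<Longrightarrow> chain \<rho> Z n y x s"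
proof (induction rule: chain.induct)
  case (chain_Suc x n y z s)
  then have "y \<in> Z" using chain_in by metis
  from chain_trans[OF chain_Suc.IH chain_single[OF this chain_Suc(1)]]
  have "chain \<rho> Z (n + 1) z x (s + \<rho> y x)" .
  then show ?case using assms[of x y] chain_Suc \<open>y \<in> Z\<close> by (simp add: add.commute)
qed (rule chain_0)

lemma chain_nonneg:
  assumes "\<And>x y. x \<in> Z \<Longrightarrow> y \<in> Z \<Longrightarrow> 0 \<le> \<rho> x y"
  shows "chain \<rho> Z n x y s \<Longrightarrow> 0 \<le> s"
  by (induction rule: chain.induct) (auto intro!: add_nonneg_nonneg assms dest: chain_in)

text \<open>The pair u, v is the step at which the accumulated weight passes \<open>t\<close>. The
  index counts steps and drops on both sides, as the induction in \<open>chain_bound\<close>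
  requires.\<close>

lemma chain_split:
  assumes "\<And>x y. x \<in> Z \<Longrightarrow> y \<in> Z \<Longrightarrow> 0 \<le> \<rho> x y"
  shows "chain \<rho> Z n x y s \<Longrightarrow> 0 < n \<Longrightarrow> 0 \<le> t \<Longrightarrow> t \<le> s \<Longrightarrow>
    \<exists>u v k l s1 s2. chain \<rho> Z k x u s1 \<and> chain \<rho> Z l v y s2 \<and> k < n \<and> l < n \<and>
      s1 \<le> t \<and> s2 \<le> s - t \<and> \<rho> u v \<le> s"
proof (induction arbitrary: t rule: chain.induct)
  case (chain_Suc x n y z s)
  have yz: "y \<in> Z" "z \<in> Z" using chain_in[OF chain_Suc(2)] by blast+
  have s: "0 \<le> s" using chain_nonneg[OF assms chain_Suc(2)] by blast
  consider "t < \<rho> x y" | "n = 0" "\<rho> x y \<le> t" | "0 < n" "\<rho> x y \<le> t" by linarith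
  then show ?case
  proof cases
    case 1
    then show ?thesis using chain_0[OF chain_Suc(1)] chain_Suc(2) s chain_Suc.prems
      by (intro exI[of _ x] exI[of _ y] exI[of _ 0] exI[of _ n] exI[of _ "0::real"] exI[of _ s]
          conjI) simp_all
  next
    \<comment> \<open>Here \<open>t\<close> is the whole weight and is never exceeded, so the last
      step is taken as the crossing one.\<close>
    case 2
    then have "y = z" using chain_0D chain_Suc(2) by metis
    then show ?thesis using chain_0[OF chain_Suc(1)] chain_0[OF yz(2)] s chain_Suc.prems 2
      by (intro exI[of _ x] exI[of _ y] exI[of _ 0] exI[of _ 0] exI[of _ "0::real"]
          exI[of _ "0::real"] conjI) simp_all
  next
    case 3
    then have "0 \<le> t - \<rho> x y" "t - \<rho> x y \<le> s" using chain_Suc.prems by auto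
    from chain_Suc.IH[OF 3(1) this]
    obtain u v k l s1 s2 where IH: "chain \<rho> Z k y u s1" "chain \<rho> Z l v z s2"
      "k < n" "l < n" "s1 \<le> t - \<rho> x y" "s2 \<le> s - (t - \<rho> x y)" "\<rho> u v \<le> s"
      by blast
    show ?thesis
      using IH chain.chain_Suc[OF chain_Suc(1) IH(1)] assms[OF chain_Suc(1) yz(1)]
      by (intro exI[of _ u] exI[of _ v] exI[of _ "Suc k"] exI[of _ l] exI[of _ "\<rho> x y + s1"]
          exI[of _ s2] conjI) simp_all
  qed
qed simp

text \<open>
  Frink's argument: a chain of total weight s is cut at the step that crosses s/2, so that both
  remaining pieces weigh at most s/2 and induction applies to them.
\<close>

lemma chain_bound:
  assumes nonneg: "\<And>x y. x \<in> Z \<Longrightarrow> y \<in> Z \<Longrightarrow> 0 \<le> \<rho> x y"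
    and zero: "\<And>x. x \<in> Z \<Longrightarrow> \<rho> x x = 0"
    and quasi: "\<And>x y z. x \<in> Z \<Longrightarrow> y \<in> Z \<Longrightarrow> z \<in> Z \<Longrightarrow> \<rho> x z \<le> K * max (\<rho> x y) (\<rho> y z)"
    and K: "1 \<le> K" "K\<^sup>2 \<le> 2"
  shows "chain \<rho> Z n x y s \<Longrightarrow> \<rho> x y \<le> 2 * s"
proof (induction n arbitrary: x y s rule: less_induct)
  case (less n)
  show ?case
  proof (cases "n = 0")
    case True
    then show ?thesis using chain_0D[of \<rho> Z x y s] chain_in[OF less.prems] less.prems zero by auto
  next
    case False
    have s: "0 \<le> s" using chain_nonneg[OF nonneg less.prems] by blast
    from False chain_split[OF nonneg less.prems, of "s / 2"] s
    obtain u v k l s1 s2 where *: "chain \<rho> Z k x u s1" "chain \<rho> Z l v y s2" "k < n" "l < n"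
      "s1 \<le> s / 2" "s2 \<le> s / 2" "\<rho> u v \<le> s"
      by auto
    have Z: "x \<in> Z" "u \<in> Z" "v \<in> Z" "y \<in> Z" using * chain_in by metis+
    have xu: "\<rho> x u \<le> s" "\<rho> v y \<le> s"
      using less.IH[OF *(3) *(1)] less.IH[OF *(4) *(2)] * by auto
    \<comment> \<open>All three pieces, from x to u, u to v and v to y, have size at most s. Joining
      them takes two uses of \<open>quasi\<close>, hence a factor K squared, which is at most
      2.\<close>
    have "\<rho> x v \<le> K * max (\<rho> x u) (\<rho> u v)" using quasi Z by blast
    also have "\<dots> \<le> K * s" using xu * K by (intro mult_left_mono) auto
    finally have xv: "\<rho> x v \<le> K * s" .
    have "1 * s \<le> K * s" using K s by (intro mult_right_mono) auto
    then have "max (\<rho> x v) (\<rho> v y) \<le> K * s" using xv xu by simp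
    then have "K * max (\<rho> x v) (\<rho> v y) \<le> K * (K * s)" using K by (intro mult_left_mono) auto
    then have "\<rho> x y \<le> K * (K * s)" using quasi[of x v y] Z by simp
    also have "\<dots> = K\<^sup>2 * s" by (simp add: power2_eq_square)
    also have "\<dots> \<le> 2 * s" using K s by (intro mult_right_mono) auto
    finally show ?thesis .
  qed
qed

lemma quasi_ultrametric_metrizable:
  assumes nonneg: "\<And>x y. x \<in> Z \<Longrightarrow> y \<in> Z \<Longrightarrow> 0 \<le> \<rho> x y"
    and zero: "\<And>x y. x \<in> Z \<Longrightarrow> y \<in> Z \<Longrightarrow> \<rho> x y = 0 \<longleftrightarrow> x = y"
    and sym: "\<And>x y. x \<in> Z \<Longrightarrow> y \<in> Z \<Longrightarrow> \<rho> x y = \<rho> y x"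
    and quasi: "\<And>x y z. x \<in> Z \<Longrightarrow> y \<in> Z \<Longrightarrow> z \<in> Z \<Longrightarrow> \<rho> x z \<le> K * max (\<rho> x y) (\<rho> y z)"
    and K: "1 \<le> K" "K\<^sup>2 \<le> 2"
  obtains D where "Metric_space Z D"
    and "\<And>x y. x \<in> Z \<Longrightarrow> y \<in> Z \<Longrightarrow> \<rho> x y / 2 \<le> D x y \<and> D x y \<le> \<rho> x y"
proof -
  define C where "C x y = {s. \<exists>n. chain \<rho> Z n x y s}" for x y
  \<comment> \<open>\<open>Metric_space\<close> asks for non-negativity and symmetry at all
    arguments, hence the value 0 outside \<open>Z\<close>.\<close>
  define D where "D x y = (if x \<in> Z \<and> y \<in> Z then Inf (C x y) else 0)" for x y
  have ne: "\<rho> x y \<in> C x y" if "x \<in> Z" "y \<in> Z" for x y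
    using chain_single[OF that] by (auto simp: C_def)
  have bdd: "bdd_below (C x y)" for x y
    using chain_nonneg[of Z \<rho>, OF nonneg] unfolding C_def bdd_below_def by blast
  have lower: "\<rho> x y / 2 \<le> D x y" if "x \<in> Z" "y \<in> Z" for x y
  proof -
    have "\<rho> x y / 2 \<le> s" if "s \<in> C x y" for s
    proof -
      from that obtain n where "chain \<rho> Z n x y s" by (auto simp: C_def)
      from chain_bound[OF nonneg _ quasi K this] zero K have "\<rho> x y \<le> 2 * s" by simp
      then show ?thesis by simp
    qed
    then have "\<rho> x y / 2 \<le> Inf (C x y)" using ne[OF that] by (intro cInf_greatest) auto
    then show ?thesis using that by (simp add: D_def)
  qed
  have upper: "D x y \<le> \<rho> x y" if "x \<in> Z" "y \<in> Z" for x y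
    using ne[OF that] bdd that by (auto simp: D_def intro: cInf_lower)
  have "Metric_space Z D"
  proof
    show "0 \<le> D x y" for x y
      using lower[of x y] nonneg[of x y] by (cases "x \<in> Z \<and> y \<in> Z") (auto simp: D_def)
    have "C x y = C y x" for x y
      using chain_rev[of Z \<rho>, OF sym] unfolding C_def by blast
    then show "D x y = D y x" for x y by (auto simp: D_def)
    show "D x y = 0 \<longleftrightarrow> x = y" if "x \<in> Z" "y \<in> Z" for x y
      using lower[OF that] upper[OF that] nonneg[OF that] zero[OF that] by auto
    show "D x z \<le> D x y + D y z" if Z: "x \<in> Z" "y \<in> Z" "z \<in> Z" for x y z
    proof -
      have "D x z - s \<le> t" if st: "s \<in> C x y" "t \<in> C y z" for s t
      proof -
        obtain n m where "chain \<rho> Z n x y s" "chain \<rho> Z m y z t"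
          using st unfolding C_def by blast
        from chain_trans[OF this] have "s + t \<in> C x z" by (auto simp: C_def)
        then have "Inf (C x z) \<le> s + t" using bdd by (rule cInf_lower)
        then show ?thesis using Z by (simp add: D_def)
      qed
      then have "D x z - s \<le> Inf (C y z)" if "s \<in> C x y" for s
        using that ne[OF Z(2,3)] by (intro cInf_greatest) blast+
      then have "D x z - Inf (C y z) \<le> s" if "s \<in> C x y" for s using that by fastforce
      then have "D x z - Inf (C y z) \<le> Inf (C x y)"
        using ne[OF Z(1,2)] by (intro cInf_greatest) blast+
      then show ?thesis using Z by (simp add: D_def)
    qed
  qed
  then show ?thesis using that lower upper by blast
qed

lemma inverse_power_le_iff:
  assumes "1 < a" "0 \<le> t"
  shows "inverse_power a t \<le> a powr (- r) \<longleftrightarrow> ereal r \<le> t"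
  using assms by (cases t) (auto simp: inverse_power_def)

lemma inverse_power_nonneg: "0 \<le> inverse_power a t"
  by (simp add: inverse_power_def)

lemma inverse_power_eq_0_iff:
  assumes "1 < a"
  shows "inverse_power a t = 0 \<longleftrightarrow> t = \<infinity>"
  using assms by (simp add: inverse_power_def)

section \<open>Visual metrics: existence and comparison\<close>

context hyperbolic_space
begin

lemma visual_metric_exists:
  assumes b: "b \<in> X"
  shows "\<exists>D. visual_metric X d D"
proof -
  \<comment> \<open>With this base, K squared is exactly 2, the largest value that the chain
    argument admits.\<close>
  define a where "a = 2 powr (1 / (6 * \<delta> + 2))"
  have "2 powr 0 < a" unfolding a_def using delta by (subst powr_less_cancel_iff) auto
  then have a: "1 < a" by simp
  define K where "K = a powr (3 * \<delta> + 1)"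
  have "K\<^sup>2 = 2 powr ((6 * \<delta> + 2) / (6 * \<delta> + 2))"
    unfolding K_def a_def power2_eq_square by (simp add: powr_powr flip: powr_add add_divide_distrib)
  then have K: "1 \<le> K" "K\<^sup>2 \<le> 2"
    using a delta by (auto simp: K_def ge_one_powr_ge_zero)
  define \<rho> where "\<rho> \<xi> \<eta> = inverse_power a (bp b \<xi> \<eta>)" for \<xi> \<eta>
  have zero: "\<rho> \<xi> \<eta> = 0 \<longleftrightarrow> \<xi> = \<eta>" if "\<xi> \<in> bd" "\<eta> \<in> bd" for \<xi> \<eta>
    using that a b by (simp add: \<rho>_def inverse_power_eq_0_iff bp_infinite_iff)
  have nonneg: "0 \<le> \<rho> \<xi> \<eta>" for \<xi> \<eta> by (simp add: \<rho>_def inverse_power_nonneg)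
  have le_iff: "\<rho> \<xi> \<eta> \<le> a powr (- r) \<longleftrightarrow> ereal r \<le> bp b \<xi> \<eta>"
    if "\<xi> \<in> bd" "\<eta> \<in> bd" for \<xi> \<eta> r
    unfolding \<rho>_def using that a b by (intro inverse_power_le_iff bp_nonneg)
  have quasi: "\<rho> \<xi> \<zeta> \<le> K * max (\<rho> \<xi> \<eta>) (\<rho> \<eta> \<zeta>)"
    if "\<xi> \<in> bd" "\<eta> \<in> bd" "\<zeta> \<in> bd" for \<xi> \<eta> \<zeta>
  proof (cases "max (\<rho> \<xi> \<eta>) (\<rho> \<eta> \<zeta>) = 0")
    case True
    then have "\<rho> \<xi> \<eta> = 0" "\<rho> \<eta> \<zeta> = 0"
      using nonneg[of \<xi> \<eta>] nonneg[of \<eta> \<zeta>] by (auto simp: max_def split: if_splits)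
    then have "\<xi> = \<eta>" "\<eta> = \<zeta>" using that zero by auto
    moreover have "\<rho> \<zeta> \<zeta> = 0" using that zero by simp
    ultimately show ?thesis by simp
  next
    case False
    \<comment> \<open>The larger of the two values is written as a power of \<open>a\<close>, so
      that the quasi-ultrametric inequality becomes \<open>bp_hyp\<close>; the value 0 has no
      logarithm and was treated apart.\<close>
    define r where "r = - log a (max (\<rho> \<xi> \<eta>) (\<rho> \<eta> \<zeta>))"
    have pos: "0 < max (\<rho> \<xi> \<eta>) (\<rho> \<eta> \<zeta>)"
      using False nonneg by (metis less_eq_real_def max.coboundedI1)
    then have r: "a powr (- r) = max (\<rho> \<xi> \<eta>) (\<rho> \<eta> \<zeta>)"
      using a by (simp add: r_def)
    have "ereal r \<le> bp b \<xi> \<eta>" "ereal r \<le> bp b \<eta> \<zeta>"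
      using r that by (simp_all flip: le_iff)
    then have "\<rho> \<xi> \<zeta> \<le> a powr (- (r - (3 * \<delta> + 1)))"
      using bp_hyp that b le_iff by blast
    also have "\<dots> = K * a powr (- r)"
      by (simp add: K_def flip: powr_add)
    finally show ?thesis by (simp add: r)
  qed
  have sym': "\<rho> \<xi> \<eta> = \<rho> \<eta> \<xi>" if "\<xi> \<in> bd" "\<eta> \<in> bd" for \<xi> \<eta>
    using bp_sym that by (simp add: \<rho>_def)
  obtain D where D: "Metric_space bd D"
    "\<And>\<xi> \<eta>. \<xi> \<in> bd \<Longrightarrow> \<eta> \<in> bd \<Longrightarrow> \<rho> \<xi> \<eta> / 2 \<le> D \<xi> \<eta> \<and> D \<xi> \<eta> \<le> \<rho> \<xi> \<eta>"
    by (rule quasi_ultrametric_metrizable[of bd \<rho> K, OF nonneg zero sym' quasi K]) (use that in auto)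
  have "visual_metric X d D"
    unfolding visual_metric_def
    using D a b
    by (intro conjI bexI[of _ b] exI[of _ a] exI[of _ "1/2"] exI[of _ 1]) (auto simp: \<rho>_def)
  then show ?thesis by blast
qed

text \<open>The base point of a given visual metric is arbitrary; moving it to \<open>b\<close>
  shifts products by at most a constant, which is absorbed into \<open>k1\<close> and
  \<open>k2\<close>. Stating the comparison by thresholds avoids infinite products, and it is the
  only form in which the comparison is used below.\<close>

lemma visual_metric_thresholds:
  assumes "visual_metric X d D" and b: "b \<in> X"
  obtains a k1 k2 where "1 < a" "0 < k1" "0 < k2"
    and "\<And>\<xi> \<eta> r. \<xi> \<in> bd \<Longrightarrow> \<eta> \<in> bd \<Longrightarrow> D \<xi> \<eta> \<le> k1 * a powr (- r) \<Longrightarrow> ereal r \<le> bp b \<xi> \<eta>"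
    and "\<And>\<xi> \<eta> r. \<xi> \<in> bd \<Longrightarrow> \<eta> \<in> bd \<Longrightarrow> ereal r \<le> bp b \<xi> \<eta> \<Longrightarrow> D \<xi> \<eta> \<le> k2 * a powr (- r)"
proof -
  from assms(1) obtain c a c1 c2 where c: "c \<in> X" and a: "1 < a" and c12: "0 < c1" "0 < c2"
    and D: "\<And>\<xi> \<eta>. \<xi> \<in> bd \<Longrightarrow> \<eta> \<in> bd \<Longrightarrow> c1 * inverse_power a (bp c \<xi> \<eta>) \<le> D \<xi> \<eta> \<and>
        D \<xi> \<eta> \<le> c2 * inverse_power a (bp c \<xi> \<eta>)"
    unfolding visual_metric_def by metis
  define s where "s = d b c + 2 * \<delta> + 1"
  show ?thesis
  proof (rule that[of a "c1 * a powr (- s)" "c2 * a powr s"])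
    fix \<xi> \<eta> r assume bd: "\<xi> \<in> bd" "\<eta> \<in> bd"
    have le_iff: "inverse_power a (bp c \<xi> \<eta>) \<le> a powr (- r) \<longleftrightarrow> ereal r \<le> bp c \<xi> \<eta>" for r
      using bd a c by (intro inverse_power_le_iff bp_nonneg)
    {
      assume "D \<xi> \<eta> \<le> c1 * a powr (- s) * a powr (- r)"
      then have "c1 * inverse_power a (bp c \<xi> \<eta>) \<le> c1 * (a powr (- s) * a powr (- r))"
        using D[OF bd] by (simp add: mult.assoc)
      then have "inverse_power a (bp c \<xi> \<eta>) \<le> a powr (- (r + s))"
        using c12 by (simp add: algebra_simps flip: powr_add)
      then have "ereal (r + s) \<le> bp c \<xi> \<eta>" by (simp only: le_iff)
      from bp_base[OF bd c b this] show "ereal r \<le> bp b \<xi> \<eta>"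
        using sym[OF b c] by (simp add: s_def)
    }
    {
      assume "ereal r \<le> bp b \<xi> \<eta>"
      from bp_base[OF bd b c this] have "inverse_power a (bp c \<xi> \<eta>) \<le> a powr (- (r - s))"
        by (simp only: le_iff s_def)
      then have "c2 * inverse_power a (bp c \<xi> \<eta>) \<le> c2 * a powr (s + - r)"
        using c12 by (intro mult_left_mono) auto
      then show "D \<xi> \<eta> \<le> c2 * a powr s * a powr (- r)"
        using D[OF bd] unfolding powr_add mult.assoc by linarith
    }
  qed (use a c12 in auto)
qed

end

text \<open>
  In a uniformly perfect space every small ball contains two disjoint balls of comparable radius;
  iterating this m times gives many well-separated points.
\<close>

lemma uniformly_perfect_separated:
  assumes "Metric_space Z D" and "1 < S"
    and up: "\<And>x \<epsilon>. x \<in> Z \<Longrightarrow> 0 < \<epsilon> \<Longrightarrow> \<epsilon> \<le> \<epsilon>\<^sub>0 \<Longrightarrow> \<exists>y\<in>Z. \<epsilon> / S < D x y \<and> D x y \<le> \<epsilon>"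
  shows "\<exists>T\<ge>1. \<forall>x\<in>Z. \<forall>\<epsilon>. 0 < \<epsilon> \<and> \<epsilon> \<le> \<epsilon>\<^sub>0 \<longrightarrow>
    (\<exists>F\<subseteq>Z. finite F \<and> card F = 2 ^ m \<and> (\<forall>y\<in>F. D x y \<le> \<epsilon>) \<and>
      (\<forall>y\<in>F. \<forall>z\<in>F. y \<noteq> z \<longrightarrow> \<epsilon> / T \<le> D y z))"
proof -
  interpret Metric_space Z D by fact
  show ?thesis
  proof (induction m)
    case 0
    have "\<exists>F\<subseteq>Z. finite F \<and> card F = 2 ^ 0 \<and> (\<forall>y\<in>F. D x y \<le> \<epsilon>) \<and>
        (\<forall>y\<in>F. \<forall>z\<in>F. y \<noteq> z \<longrightarrow> \<epsilon> / 1 \<le> D y z)" if "x \<in> Z" "0 < \<epsilon>" for x \<epsilon>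
      using that by (intro exI[of _ "{x}"]) auto
    then show ?case by (intro exI[of _ 1]) auto
  next
    case (Suc m)
    then obtain T where T: "1 \<le> T" and IH: "\<And>x \<epsilon>. x \<in> Z \<Longrightarrow> 0 < \<epsilon> \<Longrightarrow> \<epsilon> \<le> \<epsilon>\<^sub>0 \<Longrightarrow>
        \<exists>F\<subseteq>Z. finite F \<and> card F = 2 ^ m \<and> (\<forall>y\<in>F. D x y \<le> \<epsilon>) \<and>
          (\<forall>y\<in>F. \<forall>z\<in>F. y \<noteq> z \<longrightarrow> \<epsilon> / T \<le> D y z)"
      by metis
    have "\<exists>F\<subseteq>Z. finite F \<and> card F = 2 ^ Suc m \<and> (\<forall>y\<in>F. D x y \<le> \<epsilon>) \<and>
        (\<forall>y\<in>F. \<forall>z\<in>F. y \<noteq> z \<longrightarrow> \<epsilon> / (8 * S * T) \<le> D y z)"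
      if x: "x \<in> Z" and \<epsilon>: "0 < \<epsilon>" "\<epsilon> \<le> \<epsilon>\<^sub>0" for x \<epsilon>
    proof -
      \<comment> \<open>Perfectness at scale \<epsilon>/2 yields y with D x y above \<epsilon>/(2S),
        which is 4\<epsilon>'. Points within \<epsilon>' of x and of y are then more than
        2\<epsilon>' apart, and all of them stay within \<epsilon> of x.\<close>
      define \<epsilon>' where "\<epsilon>' = \<epsilon> / (8 * S)"
      have "\<epsilon> * 1 \<le> \<epsilon> * S" using \<epsilon> \<open>1 < S\<close> by (intro mult_left_mono) auto
      then have \<epsilon>': "0 < \<epsilon>'" "\<epsilon>' \<le> \<epsilon> / 8"
        using \<epsilon> \<open>1 < S\<close> by (auto simp: \<epsilon>'_def field_simps)
      obtain y where y: "y \<in> Z" "\<epsilon> / 2 / S < D x y" "D x y \<le> \<epsilon> / 2"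
        using up[OF x, of "\<epsilon> / 2"] \<epsilon> by auto
      have y': "4 * \<epsilon>' < D x y" using y \<open>1 < S\<close> by (simp add: \<epsilon>'_def field_simps)
      obtain F where F: "F \<subseteq> Z" "finite F" "card F = 2 ^ m" "\<forall>z\<in>F. D x z \<le> \<epsilon>'"
        "\<forall>y\<in>F. \<forall>z\<in>F. y \<noteq> z \<longrightarrow> \<epsilon>' / T \<le> D y z"
        using IH[OF x \<epsilon>'(1)] \<epsilon>' \<epsilon> by auto
      obtain G where G: "G \<subseteq> Z" "finite G" "card G = 2 ^ m" "\<forall>z\<in>G. D y z \<le> \<epsilon>'"
        "\<forall>y\<in>G. \<forall>z\<in>G. y \<noteq> z \<longrightarrow> \<epsilon>' / T \<le> D y z"
        using IH[OF y(1) \<epsilon>'(1)] \<epsilon>' \<epsilon> by auto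
      have "\<epsilon>' * 1 \<le> \<epsilon>' * T" using \<epsilon>' T by (intro mult_left_mono) auto
      then have T': "\<epsilon>' / T \<le> \<epsilon>'" using T by (simp add: field_simps)
      have FG: "\<epsilon>' / T \<le> D u v" "u \<noteq> v" if "u \<in> F" "v \<in> G" for u v
      proof -
        have "D x y \<le> D x u + D u v + D v y"
          using triangle[of x u y] triangle[of u v y] that F G x y by (smt (verit) subsetD)
        then have "2 * \<epsilon>' < D u v" using that F G y' commute[of v y] by fastforce
        then show "\<epsilon>' / T \<le> D u v" "u \<noteq> v" using T' \<epsilon>' F that by auto
      qed
      have T8: "\<epsilon> / (8 * S * T) = \<epsilon>' / T" by (simp add: \<epsilon>'_def)
      have "D x z \<le> \<epsilon>" if "z \<in> G" for z
        using triangle[of x y z] that G x y \<epsilon>' by fastforce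
      moreover have "D x z \<le> \<epsilon>" if "z \<in> F" for z
        using that F \<epsilon>' \<epsilon> by fastforce
      moreover have "card (F \<union> G) = 2 ^ Suc m"
        using F(2,3) G(2,3) FG(2) by (subst card_Un_disjoint) auto
      moreover have GF: "\<epsilon>' / T \<le> D v u" if "u \<in> F" "v \<in> G" for u v
        using FG(1)[OF that] commute[of u v] by simp
      have "\<epsilon>' / T \<le> D u v" if "u \<in> F \<union> G" "v \<in> F \<union> G" "u \<noteq> v" for u v
        using that(1,2)
      proof (elim UnE)
        show "\<epsilon>' / T \<le> D u v" if "u \<in> F" "v \<in> F" using F(5) that \<open>u \<noteq> v\<close> by blast
        show "\<epsilon>' / T \<le> D u v" if "u \<in> G" "v \<in> G" using G(5) that \<open>u \<noteq> v\<close> by blast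
      qed (use FG(1) GF in blast)+
      ultimately show ?thesis
        unfolding T8 using F(1,2) G(1,2) by (intro exI[of _ "F \<union> G"]) auto
    qed
    moreover have "1 \<le> 8 * S * T"
      using T \<open>1 < S\<close> mult_mono[of 1 S 1 T] by simp
    ultimately show ?case by blast
  qed
qed

section \<open>Uniform perfectness and isoperimetry\<close>

context hyperbolic_space
begin

lemma ray_in: "geodesic_ray_from X d b \<gamma> \<Longrightarrow> 0 \<le> t \<Longrightarrow> \<gamma> t \<in> X"
  by (auto simp: geodesic_ray_from_def)

lemma ray_dist:
  "geodesic_ray_from X d b \<gamma> \<Longrightarrow> 0 \<le> s \<Longrightarrow> 0 \<le> t \<Longrightarrow> d (\<gamma> s) (\<gamma> t) = \<bar>s - t\<bar>"
  by (simp add: geodesic_ray_from_def)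

lemma ray_height: "geodesic_ray_from X d b \<gamma> \<Longrightarrow> 0 \<le> t \<Longrightarrow> d (\<gamma> t) b = t"
  using ray_dist[of b \<gamma> t 0] by (simp add: geodesic_ray_from_def)

lemma ray_gp:
  "geodesic_ray_from X d b \<gamma> \<Longrightarrow> 0 \<le> s \<Longrightarrow> 0 \<le> t \<Longrightarrow> gp b (\<gamma> s) (\<gamma> t) = min s t"
  by (auto simp: gromov_product_def ray_height ray_dist)

lemma ray_conv:
  assumes "geodesic_ray_from X d b \<gamma>" "b \<in> X"
  shows "converges_to_infinity X d (\<lambda>i. \<gamma> (real i))"
proof -
  have "\<forall>i\<ge>nat \<lceil>r\<rceil>. \<forall>j\<ge>nat \<lceil>r\<rceil>. r \<le> gp b (\<gamma> (real i)) (\<gamma> (real j))" for r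
    using assms by (auto simp: ray_gp)
  then have "\<exists>N. \<forall>i\<ge>N. \<forall>j\<ge>N. r \<le> gp b (\<gamma> (real i)) (\<gamma> (real j))" for r by blast
  then show ?thesis using assms by (auto simp: conv_iff[OF assms(2)] ray_in)
qed

lemma height_lipschitz: "x \<in> X \<Longrightarrow> y \<in> X \<Longrightarrow> b \<in> X \<Longrightarrow> \<bar>d x b - d y b\<bar> \<le> d x y"
  using tri[of x y b] tri[of y x b] sym[of x y] by simp

end

text \<open>Rays run through the whole space while counting takes place in the discrete set
  \<open>V\<close>, which \<iota> maps onto a net with balls of bounded size. The point of the ray
  compared with \<open>x\<close> is the one at the same height as \<open>x\<close>.\<close>

locale hyperbolic_net = hyperbolic_space X d \<delta>
  for X :: "'p set" and d :: "'p \<Rightarrow> 'p \<Rightarrow> real" and \<delta> :: real +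
  fixes b :: 'p and M :: real and V :: "'a set" and \<iota> :: "'a \<Rightarrow> 'p" and N :: "real \<Rightarrow> nat"
  assumes b_in: "b \<in> X" and M_nonneg: "0 \<le> M"
    and near_ray: "x \<in> X \<Longrightarrow> \<exists>\<gamma>. geodesic_ray_from X d b \<gamma> \<and> d x (\<gamma> (d x b)) \<le> M"
    and net_in: "v \<in> V \<Longrightarrow> \<iota> v \<in> X"
    and net_dense: "x \<in> X \<Longrightarrow> \<exists>v\<in>V. d x (\<iota> v) \<le> 1"
    and net_balls: "x \<in> X \<Longrightarrow> finite {v \<in> V. d x (\<iota> v) \<le> R} \<and> card {v \<in> V. d x (\<iota> v) \<le> R} \<le> N R"
begin

abbreviation "ray \<equiv> geodesic_ray_from X d b"

text \<open>The ray point at the height of \<open>x\<close> has exactly this height as its product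
  with all later ray points, and replacing it by \<open>x\<close> costs at most
  \<open>M\<close>.\<close>

lemma near_ray_gp:
  assumes "x \<in> X"
  obtains \<gamma> where "ray \<gamma>" "\<And>t. d x b \<le> t \<Longrightarrow> d x b - M \<le> gp b x (\<gamma> t)"
proof -
  obtain \<gamma> where \<gamma>: "ray \<gamma>" "d x (\<gamma> (d x b)) \<le> M" using near_ray[OF assms] by blast
  have "d x b - M \<le> gp b x (\<gamma> t)" if "d x b \<le> t" for t
  proof -
    have h: "0 \<le> d x b" "0 \<le> t" using nonneg[OF assms b_in] that by auto
    then have "gp b (\<gamma> t) (\<gamma> (d x b)) - d (\<gamma> (d x b)) x \<le> gp b (\<gamma> t) x"
      using \<gamma> assms b_in by (intro gp_lipschitz) (auto intro: ray_in)
    then show ?thesis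
      using \<gamma> h that assms by (simp add: ray_gp gp_sym[of "\<gamma> t"] sym[of "\<gamma> (d x b)"] ray_in)
  qed
  then show ?thesis using that \<gamma> by blast
qed

text \<open>
  A ray passing near a far term of the sequence z already fellow-travels with \<xi> up to height s, so
  that no Arzela-Ascoli argument is needed.
\<close>

lemma approx_ray:
  assumes "\<xi> \<in> bd" "z \<in> \<xi>" "0 \<le> s"
  obtains \<gamma> where "ray \<gamma>"
    and "\<And>t. 0 \<le> t \<Longrightarrow> t \<le> s \<Longrightarrow> \<forall>\<^sub>F i in sequentially. t - \<delta> \<le> gp b (\<gamma> t) (z i)"
proof -
  have zX: "z i \<in> X" for i using bd_in assms by blast
  \<comment> \<open>The margin \<open>M\<close> is spent when \<open>z i0\<close> is replaced by a
    nearby ray point.\<close>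
  obtain i0 where i0: "\<forall>i\<ge>i0. \<forall>j\<ge>i0. s + M \<le> gp b (z i) (z j)"
    using conv_gp[OF bd_conv[OF assms(1,2)] b_in] by blast
  define h where "h = d (z i0) b"
  have h: "s \<le> h"
    using i0[rule_format, of i0 i0] gp_le[of "z i0" "z i0" b] zX b_in M_nonneg by (simp add: h_def)
  obtain \<gamma> where \<gamma>: "ray \<gamma>" "d (z i0) (\<gamma> h) \<le> M" using near_ray[OF zX] h_def by blast
  have "t - \<delta> \<le> gp b (\<gamma> t) (z i)" if "0 \<le> t" "t \<le> s" "i \<ge> i0" for t i
  proof (rule hyp_trans)
    have X: "\<gamma> h \<in> X" "\<gamma> t \<in> X" using \<gamma> h that by (auto intro: ray_in)
    show "t \<le> gp b (\<gamma> t) (\<gamma> h)" using \<gamma> h that by (simp add: ray_gp)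
    have "gp b (z i) (z i0) - d (z i0) (\<gamma> h) \<le> gp b (z i) (\<gamma> h)"
      using zX X b_in by (intro gp_lipschitz)
    then show "t \<le> gp b (\<gamma> h) (z i)"
      using i0[rule_format, of i i0] \<gamma> that zX X by (simp add: gp_sym[of "\<gamma> h"])
    show "\<gamma> t \<in> X" "\<gamma> h \<in> X" by (fact X)+
  qed (use zX b_in in auto)
  then show ?thesis using that[OF \<gamma>(1)] unfolding eventually_sequentially by blast
qed

text \<open>
  The hypotheses say that x and x' are near a geodesic from b to y. The bound does not depend on how
  far away y is, so the number of ancestors of y at a given height is bounded uniformly.
\<close>

lemma common_descendant:
  assumes X: "x \<in> X" "x' \<in> X" "y \<in> X"
    and gp: "d x b - C \<le> gp b x y" "d x' b - C \<le> gp b x' y"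
  shows "d x x' \<le> \<bar>d x b - d x' b\<bar> + 2 * C + 2 * \<delta>"
proof -
  have "min (d x b) (d x' b) - C - \<delta> \<le> gp b x x'"
    using gp X b_in by (intro hyp_trans[of _ b x y x']) (auto simp: gp_sym[of y])
  then show ?thesis using dist_eq_gp[of x x' b] by linarith
qed

section \<open>From uniform perfectness to expansion\<close>

lemma uniformly_perfect_imp_expansion:
  assumes vis: "visual_metric X d D" and up: "uniformly_perfect bd D"
  shows "\<exists>k. \<forall>A\<subseteq>V. finite A \<longrightarrow> 2 * card A \<le> card {y \<in> V. \<exists>x\<in>A. d (\<iota> x) (\<iota> y) \<le> k}"
proof -
  obtain a k1 k2 where a: "1 < a" and k: "0 < k1" "0 < k2"
    and D1: "\<And>\<xi> \<eta> r. \<xi> \<in> bd \<Longrightarrow> \<eta> \<in> bd \<Longrightarrow> D \<xi> \<eta> \<le> k1 * a powr (- r) \<Longrightarrow> ereal r \<le> bp b \<xi> \<eta>"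
    and D2: "\<And>\<xi> \<eta> r. \<xi> \<in> bd \<Longrightarrow> \<eta> \<in> bd \<Longrightarrow> ereal r \<le> bp b \<xi> \<eta> \<Longrightarrow> D \<xi> \<eta> \<le> k2 * a powr (- r)"
    using visual_metric_thresholds[OF vis b_in] by metis
  obtain S \<epsilon>\<^sub>0 where S: "1 < S" "0 < \<epsilon>\<^sub>0"
    "\<And>x \<epsilon>. x \<in> bd \<Longrightarrow> 0 < \<epsilon> \<Longrightarrow> \<epsilon> \<le> \<epsilon>\<^sub>0 \<Longrightarrow> \<exists>y\<in>bd. \<epsilon> / S < D x y \<and> D x y \<le> \<epsilon>"
    using up unfolding uniformly_perfect_def by metis
  have met: "Metric_space bd D" using vis by (simp add: visual_metric_def)
  \<comment> \<open>The loss in the product of x with a descendant y: M for the ray near x, 1 from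
    \<open>bp_eventually\<close>, 1 for replacing a point by a net point, \<delta> from
    \<open>approx_ray\<close> and 2\<delta> from \<open>hyp_trans3\<close>.\<close>
  define C where "C = M + 2 + 3 * \<delta>"
  \<comment> \<open>Ancestors of one vertex have heights differing by at most 2, so
    \<open>common_descendant\<close> places them in one ball of this radius. The summand 1 makes B
    positive, so that it can be cancelled at the end.\<close>
  define B where "B = N (2 + 2 * C + 2 * \<delta>) + 1"
  define m where "m = 2 * B"
  have m: "2 * B \<le> 2 ^ m" unfolding m_def by (simp add: less_imp_le)
  obtain T where T: "1 \<le> T" and sep: "\<And>x \<epsilon>. x \<in> bd \<Longrightarrow> 0 < \<epsilon> \<Longrightarrow> \<epsilon> \<le> \<epsilon>\<^sub>0 \<Longrightarrow>
      \<exists>F\<subseteq>bd. finite F \<and> card F = 2 ^ m \<and> (\<forall>y\<in>F. D x y \<le> \<epsilon>) \<and>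
        (\<forall>y\<in>F. \<forall>z\<in>F. y \<noteq> z \<longrightarrow> \<epsilon> / T \<le> D y z)"
  proof -
    have "\<exists>T\<ge>1. \<forall>x\<in>bd. \<forall>\<epsilon>. 0 < \<epsilon> \<and> \<epsilon> \<le> \<epsilon>\<^sub>0 \<longrightarrow>
        (\<exists>F\<subseteq>bd. finite F \<and> card F = 2 ^ m \<and> (\<forall>y\<in>F. D x y \<le> \<epsilon>) \<and>
          (\<forall>y\<in>F. \<forall>z\<in>F. y \<noteq> z \<longrightarrow> \<epsilon> / T \<le> D y z))"
      by (rule uniformly_perfect_separated[OF met S(1)]) (rule S(3))
    then show ?thesis using that by metis
  qed
  \<comment> \<open>Below, the scale at height t is \<kappa> times a to the power -t. It must stay
    below \<open>\<epsilon>\<^sub>0\<close> for all t, and below k1 times the same power for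
    \<open>D1\<close> to give products of at least t.\<close>
  define \<kappa> where "\<kappa> = min \<epsilon>\<^sub>0 k1"
  have \<kappa>: "0 < \<kappa>" "\<kappa> \<le> \<epsilon>\<^sub>0" "\<kappa> \<le> k1" using S k by (auto simp: \<kappa>_def)
  \<comment> \<open>Boundary points with product at least t + R' will have distance below c k2 times
    a to the power -t, which is the separation at height t. R exceeds R' by the losses 1 + 3\<delta>
    in comparing sequences and 2\<delta> in \<open>bp_ge\<close>.\<close>
  define c where "c = \<kappa> / (T * k2)"
  have c: "0 < c" using \<kappa> T k by (simp add: c_def)
  define R' where "R' = max 0 (1 - log a c)"
  define R where "R = R' + 1 + 5 * \<delta>"
  have R: "0 \<le> R" using delta by (simp add: R_def R'_def)
  have R': "a powr (- R') < c"
  proof -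
    have "a powr (- R') < a powr (log a c)"
      using a by (subst powr_less_cancel_iff) (auto simp: R'_def)
    then show ?thesis using a c by simp
  qed
  have "\<exists>Y\<subseteq>V. card Y = 2 ^ m \<and> (\<forall>y\<in>Y. \<bar>d (\<iota> y) b - (d (\<iota> x) b + R)\<bar> \<le> 1 \<and>
      d (\<iota> x) b - C \<le> gp b (\<iota> x) (\<iota> y))" if x: "x \<in> V" for x
  proof -
    define t where "t = d (\<iota> x) b"
    have t: "0 \<le> t" using nonneg net_in x b_in by (simp add: t_def)
    obtain \<gamma> where \<gamma>: "ray \<gamma>" "\<And>s. t \<le> s \<Longrightarrow> t - M \<le> gp b (\<iota> x) (\<gamma> s)"
      using near_ray_gp[OF net_in[OF x]] unfolding t_def by blast
    define g where "g i = \<gamma> (real i)" for i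
    define \<xi> where "\<xi> = boundary_equiv X d `` {g}"
    have \<xi>: "\<xi> \<in> bd" "g \<in> \<xi>"
      using conv_bd[OF ray_conv[OF \<gamma>(1) b_in]] by (auto simp: \<xi>_def g_def[abs_def])
    define \<epsilon> where "\<epsilon> = \<kappa> * a powr (- t)"
    have "a powr (- t) \<le> a powr 0" using a t by (subst powr_le_cancel_iff) auto
    then have "a powr (- t) \<le> 1" using a by simp
    then have "\<kappa> * a powr (- t) \<le> \<kappa> * 1" using \<kappa> by (intro mult_left_mono) auto
    then have \<epsilon>: "0 < \<epsilon>" "\<epsilon> \<le> \<epsilon>\<^sub>0" using \<kappa> a unfolding \<epsilon>_def by (simp, linarith)
    have \<epsilon>k: "\<epsilon> \<le> k1 * a powr (- t)" unfolding \<epsilon>_def using \<kappa> by (intro mult_right_mono) auto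
    obtain F where F: "F \<subseteq> bd" "finite F" "card F = 2 ^ m" "\<forall>\<eta>\<in>F. D \<xi> \<eta> \<le> \<epsilon>"
      "\<forall>\<eta>\<in>F. \<forall>\<zeta>\<in>F. \<eta> \<noteq> \<zeta> \<longrightarrow> \<epsilon> / T \<le> D \<eta> \<zeta>"
      using sep[OF \<xi>(1) \<epsilon>] by metis
    \<comment> \<open>\<open>Q \<eta> y\<close> says that y is within 1 of a point at height t + R
      on the way to \<eta>. If two boundary points shared such a y, they would be closer than their
      separation allows, so choosing y is injective.\<close>
    define Q where "Q \<eta> y \<longleftrightarrow> (\<exists>p\<in>X. d p b = t + R \<and> d p (\<iota> y) \<le> 1 \<and>
        (\<exists>z\<in>\<eta>. \<forall>\<^sub>F i in sequentially. t + R - \<delta> \<le> gp b p (z i)))" for \<eta> y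
    have "\<exists>y\<in>V. Q \<eta> y \<and> \<bar>d (\<iota> y) b - (t + R)\<bar> \<le> 1 \<and> t - C \<le> gp b (\<iota> x) (\<iota> y)"
      if \<eta>: "\<eta> \<in> F" for \<eta>
    proof -
      have \<eta>bd: "\<eta> \<in> bd" using \<eta> F by blast
      obtain z where z: "z \<in> \<eta>" using bd_nonempty \<eta>bd by blast
      obtain \<beta> where \<beta>: "ray \<beta>" and
        \<beta>z: "\<And>s. 0 \<le> s \<Longrightarrow> s \<le> t + R \<Longrightarrow> \<forall>\<^sub>F i in sequentially. s - \<delta> \<le> gp b (\<beta> s) (z i)"
        using approx_ray[OF \<eta>bd z, of "t + R"] t R by (metis add_nonneg_nonneg)
      define p where "p = \<beta> (t + R)"
      have p: "p \<in> X" "d p b = t + R" using \<beta> t R by (auto simp: p_def ray_in ray_height)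
      have pz: "\<forall>\<^sub>F i in sequentially. t + R - \<delta> \<le> gp b p (z i)"
        using \<beta>z[of "t + R"] t R by (simp add: p_def)
      obtain y where y: "y \<in> V" "d p (\<iota> y) \<le> 1" using net_dense[OF p(1)] by blast
      have "ereal t \<le> bp b \<xi> \<eta>" using D1[OF \<xi>(1) \<eta>bd] F(4) \<eta> \<epsilon>k by fastforce
      then have "\<forall>\<^sub>F i in sequentially. t - 1 \<le> gp b (g i) (z i)"
        by (rule bp_eventually) (use \<xi> z in auto)
      with pz eventually_ge_at_top[of "nat \<lceil>t\<rceil>"]
      have "\<forall>\<^sub>F i in sequentially. t + R - \<delta> \<le> gp b p (z i) \<and> i \<ge> nat \<lceil>t\<rceil> \<and>
          t - 1 \<le> gp b (g i) (z i)"
        by (intro eventually_conj)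
      then obtain i where i: "t + R - \<delta> \<le> gp b p (z i)" "i \<ge> nat \<lceil>t\<rceil>" "t - 1 \<le> gp b (g i) (z i)"
        using eventually_happens'[OF sequentially_bot] by blast
      have X: "z i \<in> X" "g i \<in> X" using \<eta>bd z \<gamma> by (auto simp: bd_in g_def ray_in)
      have "t - M \<le> gp b (\<iota> x) (g i)" using \<gamma>(2)[of "real i"] i(2) by (simp add: g_def)
      then have "t - (M + 1 + \<delta>) - 2 * \<delta> \<le> gp b (\<iota> x) p"
        using i X p R delta M_nonneg b_in net_in[OF x]
        by (intro hyp_trans3[of _ b "\<iota> x" "g i" "z i" p]) (auto simp: gp_sym[of "z i" p])
      moreover have "gp b (\<iota> x) p - d p (\<iota> y) \<le> gp b (\<iota> x) (\<iota> y)"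
        using x y p b_in net_in by (intro gp_lipschitz) auto
      ultimately have "t - C \<le> gp b (\<iota> x) (\<iota> y)" using y by (simp add: C_def)
      moreover have "\<bar>d p b - d (\<iota> y) b\<bar> \<le> d p (\<iota> y)"
        using p y b_in net_in by (intro height_lipschitz) auto
      moreover have "Q \<eta> y" using p y z pz by (auto simp: Q_def)
      ultimately show ?thesis using p y by (intro bexI[of _ y]) auto
    qed
    then obtain f where f: "\<And>\<eta>. \<eta> \<in> F \<Longrightarrow> f \<eta> \<in> V \<and> Q \<eta> (f \<eta>) \<and>
        \<bar>d (\<iota> (f \<eta>)) b - (t + R)\<bar> \<le> 1 \<and> t - C \<le> gp b (\<iota> x) (\<iota> (f \<eta>))"
      by metis
    have "inj_on f F"
    proof (rule inj_onI, rule ccontr)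
      fix \<eta> \<zeta> assume \<eta>\<zeta>: "\<eta> \<in> F" "\<zeta> \<in> F" "f \<eta> = f \<zeta>" "\<eta> \<noteq> \<zeta>"
      then have bd: "\<eta> \<in> bd" "\<zeta> \<in> bd" using F by auto
      define y where "y = f \<eta>"
      have "Q \<eta> y" "Q \<zeta> y" and y: "\<iota> y \<in> X"
        using f[OF \<eta>\<zeta>(1)] f[OF \<eta>\<zeta>(2)] \<eta>\<zeta>(3) net_in by (simp_all add: y_def)
      then obtain p z q w where p: "p \<in> X" "d p b = t + R" "d p (\<iota> y) \<le> 1" "z \<in> \<eta>"
          "\<forall>\<^sub>F i in sequentially. t + R - \<delta> \<le> gp b p (z i)"
        and q: "q \<in> X" "d q b = t + R" "d q (\<iota> y) \<le> 1" "w \<in> \<zeta>"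
          "\<forall>\<^sub>F i in sequentially. t + R - \<delta> \<le> gp b q (w i)"
        unfolding Q_def by metis
      have "d p q \<le> 2" using tri[of p "\<iota> y" q] sym[of q "\<iota> y"] p q y by simp
      then have pq: "t + R - 1 \<le> gp b p q" using dist_eq_gp[of p q b] p q by simp
      have "\<forall>\<^sub>F i in sequentially. t + R - (1 + \<delta>) - 2 * \<delta> \<le> gp b (z i) (w i)"
        using eventually_conj[OF p(5) q(5)]
      proof (rule eventually_mono)
        fix i assume i: "t + R - \<delta> \<le> gp b p (z i) \<and> t + R - \<delta> \<le> gp b q (w i)"
        have X: "z i \<in> X" "w i \<in> X" using bd_in bd p q by auto
        show "t + R - (1 + \<delta>) - 2 * \<delta> \<le> gp b (z i) (w i)"
          using i X p(1) q(1) pq delta b_in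
          by (intro hyp_trans3[of _ b "z i" p q "w i"]) (auto simp: gp_sym[of "z i" p])
      qed
      then have "\<exists>\<^sub>F i in sequentially. t + R - (1 + \<delta>) - 2 * \<delta> \<le> gp b (z i) (w i)"
        by (simp add: eventually_frequently)
      from bp_ge[OF bd p(4) q(4) b_in this]
      have "ereal (t + R') \<le> bp b \<eta> \<zeta>" by (simp add: R_def algebra_simps)
      from D2[OF bd this] have "D \<eta> \<zeta> \<le> k2 * (a powr (- R') * a powr (- t))"
        by (simp add: algebra_simps flip: powr_add)
      also have "\<dots> < k2 * (c * a powr (- t))"
        using R' k a by (intro mult_strict_left_mono mult_strict_right_mono) auto
      also have "\<dots> = \<epsilon> / T" using k T by (simp add: c_def \<epsilon>_def)
      finally show False using F(5) \<eta>\<zeta> by fastforce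
    qed
    then have "card (f ` F) = 2 ^ m" using F by (simp add: card_image)
    then show ?thesis unfolding t_def[symmetric] using f by (intro exI[of _ "f ` F"]) auto
  qed
  then obtain Y where Y: "\<And>x. x \<in> V \<Longrightarrow> Y x \<subseteq> V \<and> card (Y x) = 2 ^ m \<and>
      (\<forall>y\<in>Y x. \<bar>d (\<iota> y) b - (d (\<iota> x) b + R)\<bar> \<le> 1 \<and> d (\<iota> x) b - C \<le> gp b (\<iota> x) (\<iota> y))"
    by metis
  \<comment> \<open>If x has height t, then y in \<open>Y x\<close> has height at most t + R + 1 and
    product at least t - C with x, which gives this radius.\<close>
  have "2 * card A \<le> card {y \<in> V. \<exists>x\<in>A. d (\<iota> x) (\<iota> y) \<le> R + 1 + 2 * C}"
    if A: "A \<subseteq> V" "finite A" for A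
  proof -
    define W where "W = {y \<in> V. \<exists>x\<in>A. d (\<iota> x) (\<iota> y) \<le> R + 1 + 2 * C}"
    have "W = (\<Union>x\<in>A. {y \<in> V. d (\<iota> x) (\<iota> y) \<le> R + 1 + 2 * C})" by (auto simp: W_def)
    then have finW: "finite W" using A net_balls net_in by auto
    have YW: "Y x \<subseteq> W" if "x \<in> A" for x
    proof
      fix y assume y: "y \<in> Y x"
      have "d (\<iota> x) (\<iota> y) \<le> R + 1 + 2 * C"
        using Y[of x] y A that dist_eq_gp[of "\<iota> x" "\<iota> y" b] by fastforce
      then show "y \<in> W" using Y y A that by (auto simp: W_def)
    qed
    have "card {x \<in> A. y \<in> Y x} \<le> B" if y: "y \<in> W" for y
    proof (cases "{x \<in> A. y \<in> Y x} = {}")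
      case False
      then obtain x where x: "x \<in> A" "y \<in> Y x" by blast
      have "d (\<iota> x) (\<iota> x') \<le> 2 + 2 * C + 2 * \<delta>" if x': "x' \<in> A" "y \<in> Y x'" for x'
      proof -
        have V: "x \<in> V" "x' \<in> V" "y \<in> V" using x x' A y by (auto simp: W_def)
        have "d (\<iota> x) (\<iota> x') \<le> \<bar>d (\<iota> x) b - d (\<iota> x') b\<bar> + 2 * C + 2 * \<delta>"
          using Y[OF V(1)] Y[OF V(2)] x x' V net_in
          by (intro common_descendant[of "\<iota> x" "\<iota> x'" "\<iota> y"]) auto
        moreover have "\<bar>d (\<iota> y) b - (d (\<iota> x) b + R)\<bar> \<le> 1" "\<bar>d (\<iota> y) b - (d (\<iota> x') b + R)\<bar> \<le> 1"
          using Y[OF V(1)] Y[OF V(2)] x x' by auto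
        ultimately show ?thesis by linarith
      qed
      then have "{x' \<in> A. y \<in> Y x'} \<subseteq> {x' \<in> V. d (\<iota> x) (\<iota> x') \<le> 2 + 2 * C + 2 * \<delta>}"
        using A by auto
      moreover have "finite {x' \<in> V. d (\<iota> x) (\<iota> x') \<le> 2 + 2 * C + 2 * \<delta>} \<and>
          card {x' \<in> V. d (\<iota> x) (\<iota> x') \<le> 2 + 2 * C + 2 * \<delta>} \<le> N (2 + 2 * C + 2 * \<delta>)"
        using x A net_in by (intro net_balls) auto
      ultimately show ?thesis unfolding B_def by (meson card_mono order_trans le_add1)
    next
      case True
      show ?thesis unfolding True by simp
    qed
    then have "(\<Sum>y\<in>W. card {x \<in> A. y \<in> Y x}) \<le> card W * B"
      using sum_bounded_above[of W "\<lambda>y. card {x \<in> A. y \<in> Y x}" B] by simp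
    \<comment> \<open>The pairs with y in \<open>Y x\<close> are counted twice: each x has
      \<open>2 ^ m\<close> partners, at least 2B, and each y has at most B.\<close>
    moreover have "(\<Sum>x\<in>A. card {y \<in> W. y \<in> Y x}) = (\<Sum>y\<in>W. card {x \<in> A. y \<in> Y x})"
      using A finW by (intro sum_multicount_gen) auto
    moreover have "(\<Sum>x\<in>A. card {y \<in> W. y \<in> Y x}) = card A * 2 ^ m"
    proof -
      have "card {y \<in> W. y \<in> Y x} = 2 ^ m" if "x \<in> A" for x
      proof -
        have "{y \<in> W. y \<in> Y x} = Y x" using YW[OF that] by blast
        then show ?thesis using Y[of x] A that by auto
      qed
      then show ?thesis by simp
    qed
    moreover have "card A * (2 * B) \<le> card A * 2 ^ m" using m by (rule mult_left_mono) simp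
    ultimately have "card A * (2 * B) \<le> card W * B" by linarith
    then have "2 * card A * B \<le> card W * B" by (simp only: mult.assoc mult.left_commute)
    moreover have "0 < B" by (simp add: B_def)
    ultimately show ?thesis unfolding W_def[symmetric] by simp
  qed
  then show ?thesis by blast
qed

text \<open>
  If no boundary point lies in a thick annulus around \<xi>, the net points near the part of a ray
  towards \<xi> at the corresponding heights form a tube whose boundary sits at its two ends.
\<close>

lemma isoperimetry_imp_annulus:
  fixes h :: real
  assumes h: "0 < h"
    and iso: "\<And>A. A \<subseteq> V \<Longrightarrow> finite A \<Longrightarrow> A \<noteq> {} \<Longrightarrow>
      h * card A \<le> card {y \<in> V - A. \<exists>x\<in>A. d (\<iota> x) (\<iota> y) \<le> 1}"
  shows "\<exists>L. \<forall>\<xi>\<in>bd. \<forall>r\<ge>0. \<exists>\<eta>\<in>bd. ereal r \<le> bp b \<xi> \<eta> \<and> bp b \<xi> \<eta> \<le> ereal (r + L)"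
proof -
  \<comment> \<open>Twice the loss in the strong estimate in \<open>tube\<close>, since two points
    at height t with product t - q are at distance 2q.\<close>
  define Q where "Q = 2 * (M + 1 + 3 * \<delta>)"
  \<comment> \<open>The loss in the weak estimate: Q/2 + 1 for a vertex within Q + 2 of the ray, M
    for its own ray, \<delta> from \<open>approx_ray\<close>, and 2\<delta> each from
    \<open>hyp_trans3\<close> and \<open>bp_ge\<close>. Heights of at least r + C thus force
    products of at least r.\<close>
  define C where "C = Q / 2 + 1 + M + 5 * \<delta>"
  \<comment> \<open>A boundary vertex is within Q + 2 of the ray point at its height, and this
    height is within 1 of an end of the tube.\<close>
  define B where "B = N (Q + 3)"
  obtain n :: nat where n: "2 * real B < h * real n"
    using reals_Archimedean3[OF h] by (auto simp: mult.commute)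
  \<comment> \<open>Room for n sample heights with spacing 3; each is met by a net point up to an
    error of 1, so the net points found are distinct.\<close>
  define L where "L = C + 3 * real n + 2"
  have Q: "2 \<le> Q" using delta M_nonneg by (simp add: Q_def)
  then have C: "0 < C" using delta M_nonneg by (simp add: C_def)
  then have L: "0 < L" by (simp add: L_def)
  have "\<exists>\<eta>\<in>bd. ereal r \<le> bp b \<xi> \<eta> \<and> bp b \<xi> \<eta> \<le> ereal (r + L)"
    if \<xi>: "\<xi> \<in> bd" and r: "0 \<le> r" for \<xi> r
  proof (rule ccontr)
    assume "\<not> ?thesis"
    then have gap: "ereal (r + L) < bp b \<xi> \<eta>" if "\<eta> \<in> bd" "ereal r \<le> bp b \<xi> \<eta>" for \<eta>
      using that by force
    obtain z where z: "z \<in> \<xi>" using bd_nonempty \<xi> by blast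
    have zX: "z i \<in> X" for i using bd_in \<xi> z by blast
    obtain \<gamma> where \<gamma>: "ray \<gamma>" and \<gamma>z: "\<And>t. 0 \<le> t \<Longrightarrow> t \<le> r + L \<Longrightarrow>
        \<forall>\<^sub>F i in sequentially. t - \<delta> \<le> gp b (\<gamma> t) (z i)"
      using approx_ray[OF \<xi> z, of "r + L"] r L by (metis add_nonneg_nonneg less_imp_le)
    \<comment> \<open>Self-improvement: the weak bound Q + 2 puts the end \<eta> of a ray near y
      into the range where the gap applies. The gap lifts the product of \<xi> and \<eta> above r +
      L, hence above t, and repeating the comparison through \<eta> gives a loss free of Q.\<close>
    have tube: "d (\<iota> y) (\<gamma> (d (\<iota> y) b)) \<le> Q"
      if y: "y \<in> V" "r + C \<le> d (\<iota> y) b" "d (\<iota> y) b \<le> r + L" "d (\<iota> y) (\<gamma> (d (\<iota> y) b)) \<le> Q + 2" for y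
    proof -
      define t where "t = d (\<iota> y) b"
      have t: "0 \<le> t" "r + C \<le> t" "t \<le> r + L" using y r C by (auto simp: t_def)
      have yX: "\<iota> y \<in> X" and \<gamma>X: "\<gamma> t \<in> X" using y net_in \<gamma> t by (auto intro: ray_in)
      obtain \<beta> where \<beta>: "ray \<beta>" "\<And>s. t \<le> s \<Longrightarrow> t - M \<le> gp b (\<iota> y) (\<beta> s)"
        using near_ray_gp[OF yX] unfolding t_def by blast
      define g where "g i = \<beta> (real i)" for i
      define \<eta> where "\<eta> = boundary_equiv X d `` {g}"
      have \<eta>: "\<eta> \<in> bd" "g \<in> \<eta>"
        using conv_bd[OF ray_conv[OF \<beta>(1) b_in]] by (auto simp: \<eta>_def g_def[abs_def])
      have gX: "g i \<in> X" for i using \<beta> by (simp add: g_def ray_in)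
      have yg: "\<forall>\<^sub>F i in sequentially. t - M \<le> gp b (\<iota> y) (g i)"
        using eventually_ge_at_top[of "nat \<lceil>t\<rceil>"]
      proof (rule eventually_mono)
        fix i assume "nat \<lceil>t\<rceil> \<le> i"
        then have "t \<le> real i" by linarith
        then show "t - M \<le> gp b (\<iota> y) (g i)" using \<beta>(2) by (simp add: g_def)
      qed
      have y\<gamma>: "2 * gp b (\<iota> y) (\<gamma> t) = 2 * t - d (\<iota> y) (\<gamma> t)"
        using dist_eq_gp[of "\<iota> y" "\<gamma> t" b] \<gamma> t by (simp add: ray_height t_def)
      then have y\<gamma>': "t - (Q / 2 + 1) \<le> gp b (\<iota> y) (\<gamma> t)" using y(4) by (simp add: t_def)
      have "\<forall>\<^sub>F i in sequentially. t - (Q / 2 + 1 + M + \<delta>) - 2 * \<delta> \<le> gp b (z i) (g i)"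
        using eventually_conj[OF yg \<gamma>z[OF t(1,3)]]
      proof (rule eventually_mono)
        fix i assume i: "t - M \<le> gp b (\<iota> y) (g i) \<and> t - \<delta> \<le> gp b (\<gamma> t) (z i)"
        show "t - (Q / 2 + 1 + M + \<delta>) - 2 * \<delta> \<le> gp b (z i) (g i)"
          using i y\<gamma>' delta M_nonneg Q zX gX yX \<gamma>X b_in
          by (intro hyp_trans3[of _ b "z i" "\<gamma> t" "\<iota> y" "g i"])
            (auto simp: gp_sym[of "z i" "\<gamma> t"] gp_sym[of "\<gamma> t" "\<iota> y"])
      qed
      then have "\<exists>\<^sub>F i in sequentially. t - (Q / 2 + 1 + M + \<delta>) - 2 * \<delta> \<le> gp b (z i) (g i)"
        by (simp add: eventually_frequently)
      from bp_ge[OF \<xi> \<eta>(1) z \<eta>(2) b_in this] have "ereal (t - C) \<le> bp b \<xi> \<eta>"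
        by (simp add: C_def algebra_simps)
      then have "ereal r \<le> bp b \<xi> \<eta>" using t(2) by (metis ereal_less_eq(3) le_diff_eq order_trans)
      from gap[OF \<eta>(1) this] have "\<forall>\<^sub>F i in sequentially. t - 1 \<le> gp b (z i) (g i)"
        using t z \<eta> by (intro bp_eventually[of "r + L"]) auto
      with yg \<gamma>z[OF t(1,3)]
      have "\<forall>\<^sub>F i in sequentially. t - M \<le> gp b (\<iota> y) (g i) \<and> t - \<delta> \<le> gp b (\<gamma> t) (z i) \<and>
          t - 1 \<le> gp b (z i) (g i)"
        by (intro eventually_conj)
      then obtain i where i: "t - M \<le> gp b (\<iota> y) (g i)" "t - \<delta> \<le> gp b (\<gamma> t) (z i)"
          "t - 1 \<le> gp b (z i) (g i)"
        using eventually_happens'[OF sequentially_bot] by blast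
      have "t - (M + 1 + \<delta>) - 2 * \<delta> \<le> gp b (\<iota> y) (\<gamma> t)"
        using i delta M_nonneg zX gX yX \<gamma>X b_in
        by (intro hyp_trans3[of _ b "\<iota> y" "g i" "z i" "\<gamma> t"])
          (auto simp: gp_sym[of "z i" "\<gamma> t"] gp_sym[of "g i" "z i"])
      then show ?thesis using y\<gamma> by (simp add: Q_def t_def)
    qed
    define A where "A = {x \<in> V. r + C \<le> d (\<iota> x) b \<and> d (\<iota> x) b \<le> r + L \<and>
        d (\<iota> x) (\<gamma> (d (\<iota> x) b)) \<le> Q}"
    have "A \<subseteq> {x \<in> V. d b (\<iota> x) \<le> r + L}" using sym b_in net_in by (auto simp: A_def)
    then have A: "A \<subseteq> V" "finite A" using net_balls[OF b_in] finite_subset by (auto simp: A_def)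
    have "\<exists>v\<in>A. \<bar>d (\<iota> v) b - (r + C + 1 + 3 * real i)\<bar> \<le> 1" if i: "i < n" for i
    proof -
      define s where "s = r + C + 1 + 3 * real i"
      have s: "0 \<le> s" using r C by (simp add: s_def)
      obtain v where v: "v \<in> V" "d (\<gamma> s) (\<iota> v) \<le> 1" using net_dense[OF ray_in[OF \<gamma> s]] by blast
      have vX: "\<iota> v \<in> X" "\<gamma> s \<in> X" using net_in v \<gamma> s by (auto simp: ray_in)
      have vs: "\<bar>s - d (\<iota> v) b\<bar> \<le> 1"
        using height_lipschitz[OF vX(2,1) b_in] v \<gamma> s by (simp add: ray_height)
      have v0: "0 \<le> d (\<iota> v) b" using vX b_in nonneg by blast
      have "d (\<iota> v) (\<gamma> (d (\<iota> v) b)) \<le> d (\<iota> v) (\<gamma> s) + d (\<gamma> s) (\<gamma> (d (\<iota> v) b))"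
        using vX v0 \<gamma> by (intro tri) (auto intro: ray_in)
      then have "d (\<iota> v) (\<gamma> (d (\<iota> v) b)) \<le> Q"
        using v vs v0 s \<gamma> sym[OF vX] Q by (simp add: ray_dist)
      moreover have "real i + 1 \<le> real n" using i by linarith
      ultimately have "v \<in> A" using v vs by (auto simp: A_def s_def L_def)
      then show ?thesis using vs by (auto simp: s_def abs_minus_commute)
    qed
    then obtain f where f: "\<And>i. i < n \<Longrightarrow>
        f i \<in> A \<and> \<bar>d (\<iota> (f i)) b - (r + C + 1 + 3 * real i)\<bar> \<le> 1"
      by metis
    have "inj_on f {..<n}"
    proof (rule inj_onI)
      fix i j assume ij: "i \<in> {..<n}" "j \<in> {..<n}" "f i = f j"
      define u where "u = d (\<iota> (f j)) b"
      have "\<bar>u - (r + C + 1 + 3 * real i)\<bar> \<le> 1" "\<bar>u - (r + C + 1 + 3 * real j)\<bar> \<le> 1"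
        using f[of i] f[of j] ij by (auto simp: u_def)
      then show "i = j" by linarith
    qed
    then have "card {..<n} \<le> card A" using A f by (intro card_inj_on_le[of f]) auto
    then have cardA: "n \<le> card A" by simp
    have "0 < n" using n by (cases n) auto
    then have "A \<noteq> {}" using cardA by auto
    define E1 where "E1 = {v \<in> V. d (\<gamma> (r + C)) (\<iota> v) \<le> Q + 3}"
    define E2 where "E2 = {v \<in> V. d (\<gamma> (r + L)) (\<iota> v) \<le> Q + 3}"
    have E: "finite E1 \<and> card E1 \<le> B" "finite E2 \<and> card E2 \<le> B"
      unfolding E1_def E2_def B_def using \<gamma> r C L by (auto intro!: net_balls ray_in)
    \<comment> \<open>A step along an edge changes the height by at most 1 and the distance to the
      ray by at most 2. If the new height were still in range, \<open>tube\<close> would put y back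
      into A; so y sits at one of the two ends.\<close>
    have "{y \<in> V - A. \<exists>x\<in>A. d (\<iota> x) (\<iota> y) \<le> 1} \<subseteq> E1 \<union> E2"
    proof clarify
      fix y x assume y: "y \<in> V" "y \<notin> A" "x \<in> A" "d (\<iota> x) (\<iota> y) \<le> 1" "y \<notin> E2"
      define s t where "s = d (\<iota> x) b" and "t = d (\<iota> y) b"
      have x: "x \<in> V" "r + C \<le> s" "s \<le> r + L" "d (\<iota> x) (\<gamma> s) \<le> Q"
        using y by (auto simp: A_def s_def)
      have X: "\<iota> x \<in> X" "\<iota> y \<in> X" using x y net_in by auto
      have st: "\<bar>s - t\<bar> \<le> 1" using height_lipschitz[OF X b_in] y by (simp add: s_def t_def)
      have nn: "0 \<le> s" "0 \<le> t" using X b_in nonneg by (auto simp: s_def t_def)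
      have \<gamma>X: "\<gamma> s \<in> X" "\<gamma> t \<in> X" using nn \<gamma> by (auto intro: ray_in)
      have "d (\<iota> y) (\<gamma> t) \<le> d (\<iota> y) (\<iota> x) + d (\<iota> x) (\<gamma> s) + d (\<gamma> s) (\<gamma> t)"
        using tri[of "\<iota> y" "\<iota> x" "\<gamma> t"] tri[of "\<iota> x" "\<gamma> s" "\<gamma> t"] X \<gamma>X by simp
      then have yt: "d (\<iota> y) (\<gamma> t) \<le> Q + 2"
        using st x y sym[OF X] ray_dist[OF \<gamma> nn] by simp
      have "\<not> (r + C \<le> t \<and> t \<le> r + L)"
        using tube[of y] y yt by (auto simp: A_def t_def)
      then have "\<bar>t - (r + C)\<bar> \<le> 1 \<or> \<bar>t - (r + L)\<bar> \<le> 1" using st x by linarith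
      moreover have "d (\<gamma> u) (\<iota> y) \<le> Q + 3" if u: "\<bar>t - u\<bar> \<le> 1" "0 \<le> u" for u
      proof -
        have uX: "\<gamma> u \<in> X" using u \<gamma> by (simp add: ray_in)
        have "d (\<iota> y) (\<gamma> u) \<le> d (\<iota> y) (\<gamma> t) + d (\<gamma> t) (\<gamma> u)" using X \<gamma>X uX by (intro tri)
        then show ?thesis using yt ray_dist[OF \<gamma> nn(2) u(2)] u sym[OF X(2) uX] by simp
      qed
      ultimately show "y \<in> E1" using y r C L by (auto simp: E1_def E2_def)
    qed
    then have "card {y \<in> V - A. \<exists>x\<in>A. d (\<iota> x) (\<iota> y) \<le> 1} \<le> card (E1 \<union> E2)"
      using E by (intro card_mono) auto
    also have "\<dots> \<le> card E1 + card E2" by (rule card_Un_le)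
    finally have "card {y \<in> V - A. \<exists>x\<in>A. d (\<iota> x) (\<iota> y) \<le> 1} \<le> 2 * B" using E by linarith
    then have "real (card {y \<in> V - A. \<exists>x\<in>A. d (\<iota> x) (\<iota> y) \<le> 1}) \<le> 2 * real B" by linarith
    moreover have "h * real n \<le> h * real (card A)" using h cardA by (intro mult_left_mono) auto
    ultimately show False using iso[OF A \<open>A \<noteq> {}\<close>] n by linarith
  qed
  then show ?thesis by blast
qed

text \<open>Annuli are stated by boundary products, so the conclusion reaches every visual metric,
  in particular the one from \<open>visual_metric_exists\<close>.\<close>

lemma annulus_imp_uniformly_perfect:
  assumes vis: "visual_metric X d D"
    and ann: "\<And>\<xi> r. \<xi> \<in> bd \<Longrightarrow> 0 \<le> r \<Longrightarrow>
      \<exists>\<eta>\<in>bd. ereal r \<le> bp b \<xi> \<eta> \<and> bp b \<xi> \<eta> \<le> ereal (r + L)"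
  shows "uniformly_perfect bd D"
proof -
  obtain a k1 k2 where a: "1 < a" and k: "0 < k1" "0 < k2"
    and D1: "\<And>\<xi> \<eta> r. \<xi> \<in> bd \<Longrightarrow> \<eta> \<in> bd \<Longrightarrow> D \<xi> \<eta> \<le> k1 * a powr (- r) \<Longrightarrow> ereal r \<le> bp b \<xi> \<eta>"
    and D2: "\<And>\<xi> \<eta> r. \<xi> \<in> bd \<Longrightarrow> \<eta> \<in> bd \<Longrightarrow> ereal r \<le> bp b \<xi> \<eta> \<Longrightarrow> D \<xi> \<eta> \<le> k2 * a powr (- r)"
    using visual_metric_thresholds[OF vis b_in] by metis
  \<comment> \<open>The extra 1 beyond L makes the bound on the product strict, so that the
    contrapositive of \<open>D1\<close> gives a strict lower bound for the distance.\<close>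
  define s where "s = k1 / k2 * a powr (- (L + 1))"
  define S where "S = max 2 (1 / s)"
  have s: "0 < s" using k a by (simp add: s_def)
  then have S: "1 < S" "1 \<le> s * S"
    by (auto simp: S_def max_def field_simps)
  have "\<exists>\<eta>\<in>bd. \<epsilon> / S < D \<xi> \<eta> \<and> D \<xi> \<eta> \<le> \<epsilon>" if \<xi>: "\<xi> \<in> bd" and \<epsilon>: "0 < \<epsilon>" "\<epsilon> \<le> k2" for \<xi> \<epsilon>
  proof -
    \<comment> \<open>The scale at which \<open>D2\<close> gives exactly \<epsilon>. It is
      non-negative because \<epsilon> is at most \<open>k2\<close>, which therefore serves as the
      threshold radius.\<close>
    define r where "r = log a (k2 / \<epsilon>)"
    have r: "0 \<le> r" using a \<epsilon> k by (simp add: r_def)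
    have \<epsilon>r: "k2 * a powr (- r) = \<epsilon>" using a \<epsilon> k by (simp add: r_def powr_minus)
    obtain \<eta> where \<eta>: "\<eta> \<in> bd" "ereal r \<le> bp b \<xi> \<eta>" "bp b \<xi> \<eta> \<le> ereal (r + L)"
      using ann[OF \<xi> r] by blast
    have "\<not> ereal (r + L + 1) \<le> bp b \<xi> \<eta>"
      using \<eta>(3) by (metis add_le_same_cancel1 ereal_less_eq(3) not_one_le_zero order_trans)
    then have "k1 * a powr (- (r + L + 1)) < D \<xi> \<eta>" using D1[OF \<xi> \<eta>(1)] by force
    moreover have "k1 * a powr (- (r + L + 1)) = s * \<epsilon>"
      unfolding \<epsilon>r[symmetric] s_def using k by (simp add: algebra_simps flip: powr_add)
    moreover have "\<epsilon> / S \<le> s * \<epsilon>"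
    proof -
      have "\<epsilon> * 1 \<le> \<epsilon> * (s * S)" using S \<epsilon> by (intro mult_left_mono) auto
      then show ?thesis using S by (simp add: field_simps)
    qed
    moreover have "D \<xi> \<eta> \<le> \<epsilon>" using D2[OF \<xi> \<eta>(1,2)] \<epsilon>r by simp
    ultimately show ?thesis using \<eta>(1) by (intro bexI[of _ \<eta>]) auto
  qed
  then show ?thesis unfolding uniformly_perfect_def using S k by blast
qed

end

section \<open>The vertices as a net in the graph\<close>

theorem theorem4p15:
  fixes V :: "'a set" and E :: "('a \<times> 'a) set"
  assumes "connected_graph V E"
    and "uniform_graph V E"
    and "gromov_hyperbolic (graph_points V E) (graph_dist E)"
    and "has_pole (graph_points V E) (graph_dist E)"
  shows "cheeger_constant V E > 0 \<longleftrightarrow>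
    (\<exists>D. visual_metric (graph_points V E) (graph_dist E) D \<and>
         uniformly_perfect (gromov_boundary (graph_points V E) (graph_dist E)) D)"
proof -
  interpret G: graph V E by unfold_locales fact
  obtain \<delta> where delta: "0 \<le> \<delta>" and hyp: "\<And>x y z b. \<lbrakk>x \<in> G.X; y \<in> G.X; z \<in> G.X; b \<in> G.X\<rbrakk> \<Longrightarrow>
      gromov_product G.d b x y \<ge> min (gromov_product G.d b x z) (gromov_product G.d b z y) - \<delta>"
    using assms(3) unfolding gromov_hyperbolic_def by blast
  obtain v where v: "v \<in> G.X" and "pole_in G.X G.d v"
    using assms(4) unfolding has_pole_def by blast
  then obtain M where M: "0 < M" and pole: "\<And>x. x \<in> G.X \<Longrightarrow>
      \<exists>\<gamma>. geodesic_ray_from G.X G.d v \<gamma> \<and> (\<exists>t\<ge>0. G.d x (\<gamma> t) < M)"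
    unfolding pole_in_def by blast
  obtain N :: "real \<Rightarrow> nat" where N: "\<And>R p. p \<in> G.X \<Longrightarrow>
      finite {w \<in> V. G.d p (vertex_point w) \<le> R} \<and>
      card {w \<in> V. G.d p (vertex_point w) \<le> R} \<le> N R"
    by (rule G.bounded_balls[OF assms(2)]) (rule that)
  interpret H0: hyperbolic_space G.X G.d \<delta>
    by unfold_locales
      (use G.dist_refl G.dist_sym G.dist_triangle delta hyp in auto)
  \<comment> \<open>The pole gives some ray point within M of x. Its height differs from that of x
    by less than M, so sliding along the ray to the height of x doubles the constant.\<close>
  have near: "\<exists>\<gamma>. geodesic_ray_from G.X G.d v \<gamma> \<and> G.d x (\<gamma> (G.d x v)) \<le> 2 * M" if x: "x \<in> G.X" for x
  proof -
    obtain \<gamma> t where \<gamma>: "geodesic_ray_from G.X G.d v \<gamma>" "0 \<le> t" "G.d x (\<gamma> t) < M"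
      using pole[OF x] by blast
    have X: "\<gamma> t \<in> G.X" "0 \<le> G.d x v" "\<gamma> (G.d x v) \<in> G.X"
      using \<gamma> x v by (auto intro: H0.ray_in H0.nonneg)
    have "\<bar>G.d x v - t\<bar> < M"
      using H0.height_lipschitz[OF x X(1) v] H0.ray_height[OF \<gamma>(1,2)] \<gamma>(3) by simp
    then have "G.d (\<gamma> t) (\<gamma> (G.d x v)) < M" using H0.ray_dist[OF \<gamma>(1,2) X(2)] by simp
    then have "G.d x (\<gamma> (G.d x v)) \<le> 2 * M" using H0.tri[OF x X(1,3)] \<gamma>(3) by simp
    then show ?thesis using \<gamma> by blast
  qed
  interpret H: hyperbolic_net G.X G.d \<delta> v "2 * M" V vertex_point N
    by unfold_locales (use v M near G.vertex_in_points G.dense N in auto)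
  define bdry where "bdry A = {y \<in> V - A. \<exists>x\<in>A. G.d (vertex_point x) (vertex_point y) \<le> 1}" for A
  have cheeger: "cheeger_constant V E =
      (INF A \<in> {A. A \<subseteq> V \<and> A \<noteq> {} \<and> finite A}. real (card (bdry A)) / real (card A))"
    unfolding cheeger_constant_def bdry_def by (intro INF_cong refl) (simp add: G.vertex_boundary_eq)
  show ?thesis
  proof
    assume pos: "cheeger_constant V E > 0"
    have "cheeger_constant V E * card A \<le> card (bdry A)" if A: "A \<subseteq> V" "finite A" "A \<noteq> {}" for A
    proof -
      have "cheeger_constant V E \<le> real (card (bdry A)) / real (card A)"
        unfolding cheeger using A by (intro cINF_lower bdd_belowI2[of _ 0]) auto
      moreover have "0 < card A" using A by (simp add: card_gt_0_iff)
      ultimately show ?thesis by (simp add: field_simps)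
    qed
    from H.isoperimetry_imp_annulus[OF pos this[unfolded bdry_def]]
    obtain L where ann: "\<forall>\<xi>\<in>H0.bd. \<forall>r\<ge>0.
        \<exists>\<eta>\<in>H0.bd. ereal r \<le> H0.bp v \<xi> \<eta> \<and> H0.bp v \<xi> \<eta> \<le> ereal (r + L)"
      by blast
    obtain D where D: "visual_metric G.X G.d D" using H0.visual_metric_exists[OF v] by blast
    have "uniformly_perfect H0.bd D"
      by (rule H.annulus_imp_uniformly_perfect[OF D]) (use ann in blast)
    with D show "\<exists>D. visual_metric G.X G.d D \<and> uniformly_perfect H0.bd D" by blast
  next
    assume "\<exists>D. visual_metric G.X G.d D \<and> uniformly_perfect H0.bd D"
    then obtain D where "visual_metric G.X G.d D" "uniformly_perfect H0.bd D" by blast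
    from H.uniformly_perfect_imp_expansion[OF this] obtain k where k: "\<And>A. A \<subseteq> V \<Longrightarrow> finite A \<Longrightarrow>
        2 * card A \<le> card {y \<in> V. \<exists>x\<in>A. G.d (vertex_point x) (vertex_point y) \<le> k}"
      by blast
    \<comment> \<open>The neighbourhood has at least 2|A| vertices and is covered by A and the balls
      of radius k about the boundary, so |A| is at most N k times the size of the boundary. The
      summand 1 keeps the denominator positive.\<close>
    define c where "c = 1 / (real (N k) + 1)"
    have "c \<le> real (card (bdry A)) / real (card A)" if A: "A \<subseteq> V" "A \<noteq> {}" "finite A" for A
    proof -
      define W where "W = {y \<in> V. \<exists>x\<in>A. G.d (vertex_point x) (vertex_point y) \<le> k}"
      have "bdry A \<subseteq> (\<Union>x\<in>A. {y \<in> V. G.d (vertex_point x) (vertex_point y) \<le> 1})"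
        by (auto simp: bdry_def)
      moreover have "finite (\<Union>x\<in>A. {y \<in> V. G.d (vertex_point x) (vertex_point y) \<le> 1})"
        using A N G.vertex_in_points by auto
      ultimately have fin: "finite (bdry A)" by (rule finite_subset)
      define U where "U = (\<Union>z\<in>bdry A. {y \<in> V. G.d (vertex_point z) (vertex_point y) \<le> k})"
      have ball: "finite {y \<in> V. G.d (vertex_point z) (vertex_point y) \<le> k} \<and>
          card {y \<in> V. G.d (vertex_point z) (vertex_point y) \<le> k} \<le> N k" if "z \<in> bdry A" for z
        using that N G.vertex_in_points by (auto simp: bdry_def)
      \<comment> \<open>A shortest path from A to a vertex outside it passes a boundary vertex, from
        which the remaining distance is still at most k.\<close>
      have "W \<subseteq> A \<union> U"
      proof
        fix y assume "y \<in> W"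
        then obtain x where x: "x \<in> A" "y \<in> V" "G.d (vertex_point x) (vertex_point y) \<le> k"
          by (auto simp: W_def)
        have xV: "x \<in> V" using x A by auto
        show "y \<in> A \<union> U"
        proof (cases "y \<in> A")
          case False
          obtain z n where z: "z \<in> V - A" "\<exists>a\<in>A. (a, z) \<in> E" "n \<le> G.hops x y" "(z, y) \<in> E ^^ n"
            using G.path_leaves_through_neighbour[OF G.hops[OF xV x(2)] x(1) _ A(1)] x False by blast
          then obtain a where a: "a \<in> A" "(a, z) \<in> E" by blast
          have "G.d (vertex_point a) (vertex_point z) \<le> real 1"
            using a by (intro G.dist_le polygonal_path_relpow) simp
          then have "z \<in> bdry A" using z a by (auto simp: bdry_def)
          moreover have "G.d (vertex_point z) (vertex_point y) \<le> real n"
            by (intro G.dist_le polygonal_path_relpow z)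
          ultimately show ?thesis
            using x z G.dist_vertex[OF xV x(2)] by (auto simp: U_def intro!: bexI[of _ z])
        qed simp
      qed
      moreover have finU: "finite U" using fin ball by (auto simp: U_def)
      ultimately have "card W \<le> card (A \<union> U)" using A by (intro card_mono) auto
      also have "\<dots> \<le> card A + card U" by (rule card_Un_le)
      also have "card U \<le> (\<Sum>z\<in>bdry A. card {y \<in> V. G.d (vertex_point z) (vertex_point y) \<le> k})"
        unfolding U_def using fin by (rule card_UN_le)
      also have "\<dots> \<le> card (bdry A) * N k"
        using sum_bounded_above[of "bdry A" _ "N k"] ball by simp
      finally have "card A \<le> card (bdry A) * N k" using k[OF A(1,3)] by (simp add: W_def)
      then have "real (card A) \<le> real (card (bdry A)) * (real (N k) + 1)"
        by (simp add: algebra_simps flip: of_nat_mult)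
      moreover have "0 < card A" using A by (simp add: card_gt_0_iff)
      ultimately show ?thesis by (simp add: c_def field_simps)
    qed
    moreover have "{A. A \<subseteq> V \<and> A \<noteq> {} \<and> finite A} \<noteq> {}" using G.V_ne by auto
    ultimately have "c \<le> cheeger_constant V E"
      unfolding cheeger by (intro cINF_greatest) auto
    then show "cheeger_constant V E > 0" by (simp add: c_def less_le_trans[rotated])
  qed
qed

end
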